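(* Let $p\in(1,\infty)$, let $(X,d)$ be a complete metric space, let $\Psi$ be a scale function, and let $(X,d,m,\mathcal{E}_p,\mathcal{F}_p,\Gamma_p)$ be a regular local $p$-Dirichlet space satisfying the volume doubling property $\mathrm{VD}$ and the Poincaré inequality $\mathrm{PI}_p(\Psi)$. If $\liminf_{r\downarrow0}\frac{\Psi(r)}{r^p}=0$, then $$N^{1,p}(X;V)=L^p(X;V)$$ for every Banach space $V$, where $N^{1,p}(X;V)$ is the $V$-valued Newtonian Sobolev space.
   Context: Balls $B(x,r)$ are open $d$-balls. Regular local $p$-Dirichlet space: a tuple $(X,d,m,\mathcal{E}_p,\mathcal{F}_p,\Gamma_p)$ such that: (1) $(X,d)$ is a locally compact separable metric space with $\#X\ge 2$ and $m$ is a Radon measure on $X$ with full support. (2) $\mathcal{F}_p$ is a linear subspace of $L^p(X,m)$, $\mathcal{E}_p:\mathcal{F}_p\to[0,\infty)$, and $(\mathcal{F}_p,\mathcal{E}_{p,1}^{1/p})$ is a Banach space, where $\mathcal{E}_{p,1}(\cdot):=\mathcal{E}_p(\cdot)+\|\cdot\|_{L^p(X,m)}^p$. (3) For each $f\in\mathcal{F}_p$ there is a finite non-negative Borel measure $\Gamma_p\langle f\rangle$ on $X$ with $\Gamma_p\langle f\rangle(X)=\mathcal{E}_p(f)$ and $\Gamma_p\langle\lambda f\rangle=|\lambda|^p\Gamma_p\langle f\rangle$ for all $\lambda\in\mathbb{R}$. (4) $\Gamma_p\langle f+g\rangle(A)^{1/p}\le\Gamma_p\langle f\rangle(A)^{1/p}+\Gamma_p\langle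 g\rangle(A)^{1/p}$ for all $f,g\in\mathcal{F}_p$ and Borel $A\subset X$. (5) For $f\in\mathcal{F}_p$ and Lipschitz $g:\mathbb{R}\to\mathbb{R}$ with $g(0)=0$: $g\circ f\in\mathcal{F}_p$ and $\Gamma_p\langle g\circ f\rangle\le \mathrm{LIP}[g]^p\,\Gamma_p\langle f\rangle$, where $\mathrm{LIP}[g]$ is the smallest Lipschitz constant of $g$. (6) If $f\in\mathcal{F}_p$, $A\subset X$ is open and $f|_A$ equals a constant $m$-a.e., then $\Gamma_p\langle f\rangle(A)=0$. (7) If $f\in L^p(X,m)$, $f_j\in\mathcal{F}_p$, $f_j\to f$ in $L^p(X,m)$ and $\sup_j\mathcal{E}_p(f_j)<\infty$, then $f\in\mathcal{F}_p$ and $\Gamma_p\langle f\rangle(A)\le\liminf_{j\to\infty}\Gamma_p\langle f_j\rangle(A)$ for every Borel $A\subset X$. (8) $C_c(X)\cap\mathcal{F}_p$ is dense in $(\mathcal{F}_p,\mathcal{E}_{p,1}^{1/p})$ and in $(C_c(X),\|\cdot\|_{\sup})$. $\mathrm{VD}$: there is $C_{\mathrm{VD}}\in(1,\infty)$ with $0<m(B(x,2r))\le C_{\mathrm{VD}}\,m(B(x,r))<\infty$ for all $(x,r)\in X\times(0,\infty)$. Scale function: a continuous increasing bijection $\Psi:(0,\infty)\to(0,\infty)$ for which there are constants $C_\Psi\in[1,\infty)$, $\beta_1,\beta_2\in(0,\infty)$ with $C_\Psi^{-1}(R/r)^{\beta_1}\le\Psi(R)/\Psi(r)\le C_\Psi(R/r)^{\beta_2}$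 for all $0<r\le R<\infty$. $\mathrm{PI}_p(\Psi)$: there are $C_{\mathrm{PI}}\in(0,\infty)$, $A_{\mathrm{PI}}\in[1,\infty)$ such that for all $x\in X$, $r\in(0,\infty)$, $u\in\mathcal{F}_p$, $\int_{B(x,r)}|u-u_{B(x,r)}|^p\,dm\le C_{\mathrm{PI}}\Psi(r)\,\Gamma_p\langle u\rangle(B(x,A_{\mathrm{PI}}r))$, where $u_{B}:=m(B)^{-1}\int_B u\,dm$. Modulus: curves are non-constant continuous maps from an interval into $X$. For a family $\Gamma$ of curves, a Borel $\rho:X\to[0,\infty]$ is admissible if $\int_\gamma\rho\,ds\ge 1$ for every locally rectifiable $\gamma\in\Gamma$, and $\mathrm{Mod}_p(\Gamma):=\inf\{\int_X\rho^p\,dm:\rho\text{ admissible for }\Gamma\}$. Newtonian space: for a Banach space $V$ and $u:X\to V$, a Borel function $\rho:X\to[0,\infty]$ is a $p$-weak upper gradient of $u$ if there is a curve family $\Gamma_0$ with $\mathrm{Mod}_p(\Gamma_0)=0$ such that $\|u(\gamma(a))-u(\gamma(b))\|_V\le\int_\gamma\rho\,ds$ for every rectifiable curve $\gamma:[a,b]\to X$ not in $\Gamma_0$. Let $\widetilde N^{1,p}(X;V)$ be the set of (strongly) measurable $u:X\to V$ with $\int_X\|u\|_V^p\,dm<\infty$ that have a $p$-weak upper gradient in $L^p(X,m)$, with seminorm $\|u\|_{L^p(X;V)}+\inf_\rho\|\rho\|_{L^p(X,m)}$ (infimum over $p$-weak upper gradients $\rho$ of $u$). $N^{1,p}(X;V)$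 is the quotient of $\widetilde N^{1,p}(X;V)$ by the functions of zero seminorm. $L^p(X;V)$ is the usual Bochner space (functions identified when equal $m$-a.e.). The equality means that every $p$-integrable measurable $u:X\to V$ lies in $\widetilde N^{1,p}(X;V)$ and that two such functions are identified in $N^{1,p}(X;V)$ if and only if they agree $m$-a.e. *)

theory Defs
  imports "HOL-Analysis.Analysis"
begin

section \<open>$L^p$ functions\<close>

text \<open>The power $x^a$ of $x \in [0,\infty]$, meant for $a > 0$.\<close>

definition enn_powr :: "ennreal \<Rightarrow> real \<Rightarrow> ennreal" where
  "enn_powr x a = (if x = \<infinity> then \<infinity> else ennreal (enn2real x powr a))"

definition lp_norm :: "'a measure \<Rightarrow> real \<Rightarrow> ('a \<Rightarrow> ennreal) \<Rightarrow> ennreal" where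
  "lp_norm m p \<rho> = enn_powr (\<integral>\<^sup>+ x. enn_powr (\<rho> x) p \<partial>m) (1 / p)"

abbreviation lp_norm_vec :: "'a measure \<Rightarrow> real \<Rightarrow> ('a \<Rightarrow> 'v::real_normed_vector) \<Rightarrow> ennreal" where
  "lp_norm_vec m p u \<equiv> lp_norm m p (\<lambda>x. ennreal (norm (u x)))"

text \<open>Representatives of the elements of the scalar space $L^p(X,m)$. Every class has a measurable
  representative with respect to the given sigma-algebra, so no completion is needed here.\<close>

definition real_lp_fun :: "'a measure \<Rightarrow> real \<Rightarrow> ('a \<Rightarrow> real) set" where
  "real_lp_fun m p = {f \<in> borel_measurable m. lp_norm_vec m p f < \<infinity>}"

text \<open>The library's Bochner integral is confined to second countable target spaces, so strong
  measurability into an arbitrary Banach space is introduced here. Convergence is only required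
  almost everywhere; in particular measurability is understood modulo null sets.\<close>

definition strongly_measurable :: "'a measure \<Rightarrow> ('a \<Rightarrow> 'v::real_normed_vector) \<Rightarrow> bool" where
  "strongly_measurable m u \<longleftrightarrow>
    (\<exists>s. (\<forall>i. simple_function m (s i)) \<and> (AE x in m. (\<lambda>i. s i x) \<longlonglongrightarrow> u x))"

definition bochner_lp_fun :: "'a measure \<Rightarrow> real \<Rightarrow> ('a \<Rightarrow> 'v::real_normed_vector) set" where
  "bochner_lp_fun m p = {u. strongly_measurable m u \<and> (\<integral>\<^sup>+ x. ennreal (norm (u x) powr p) \<partial>m) < \<infinity>}"

definition bochner_lp_rel ::
    "'a measure \<Rightarrow> real \<Rightarrow> (('a \<Rightarrow> 'v::real_normed_vector) \<times> ('a \<Rightarrow> 'v)) set" where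
  "bochner_lp_rel m p =
    {(u, v). u \<in> bochner_lp_fun m p \<and> v \<in> bochner_lp_fun m p \<and> (AE x in m. u x = v x)}"

definition bochner_lp_space :: "'a measure \<Rightarrow> real \<Rightarrow> ('a \<Rightarrow> 'v::real_normed_vector) set set" where
  "bochner_lp_space m p = bochner_lp_fun m p // bochner_lp_rel m p"


section \<open>Regular local Dirichlet spaces\<close>

definition radon_measure :: "'a::topological_space measure \<Rightarrow> bool" where
  "radon_measure m \<longleftrightarrow>
    sets m = sets borel \<and>
    (\<forall>K. compact K \<longrightarrow> emeasure m K < \<infinity>) \<and>
    (\<forall>A \<in> sets borel. emeasure m A = (INF U \<in> {U. open U \<and> A \<subseteq> U}. emeasure m U)) \<and>
    (\<forall>U. open U \<longrightarrow> emeasure m U = (SUP K \<in> {K. compact K \<and> K \<subseteq> U}. emeasure m K))"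

definition compactly_supported_continuous :: "('a::topological_space \<Rightarrow> real) set"  (\<open>C\<^sub>c\<close>) where
  "C\<^sub>c = {f. continuous_on UNIV f \<and> compact (closure {x. f x \<noteq> 0})}"

definition LIP :: "(real \<Rightarrow> real) \<Rightarrow> real" where
  "LIP g = Inf {L. L-lipschitz_on UNIV g}"

definition energy_norm ::
    "'a measure \<Rightarrow> real \<Rightarrow> (('a \<Rightarrow> real) \<Rightarrow> real) \<Rightarrow> ('a \<Rightarrow> real) \<Rightarrow> real" where
  "energy_norm m p \<E> f = (\<E> f + enn2real (lp_norm_vec m p f) powr p) powr (1 / p)"

text \<open>A subspace of $L^p(X,m)$ is represented by the set \<open>\<F>\<close> of all measurable representatives
  of its elements; correspondingly \<open>\<E>\<close> and \<open>\<Gamma>\<close> do not distinguish functions that agree almost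
  everywhere. Separability of the metric space is expressed by the sort of \<open>'a\<close>.\<close>

locale regular_local_dirichlet_space =
  fixes p :: real
    and m :: "'a::{metric_space, second_countable_topology} measure"
    and \<E> :: "('a \<Rightarrow> real) \<Rightarrow> real"
    and \<F> :: "('a \<Rightarrow> real) set"
    and \<Gamma> :: "('a \<Rightarrow> real) \<Rightarrow> 'a measure"
  assumes locally_compact: "locally compact (UNIV :: 'a set)"
    and two_points: "\<exists>x y :: 'a. x \<noteq> y"
    and radon: "radon_measure m"
    and full_support: "\<And>U. \<lbrakk>open U; U \<noteq> {}\<rbrakk> \<Longrightarrow> emeasure m U > 0"
    and subset_lp: "\<F> \<subseteq> real_lp_fun m p"
    and ae_invariant: "\<And>f g. \<lbrakk>f \<in> \<F>; g \<in> borel_measurable m; AE x in m. f x = g x\<rbrakk>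
          \<Longrightarrow> g \<in> \<F> \<and> \<E> g = \<E> f \<and> \<Gamma> g = \<Gamma> f"
    and zero_mem: "(\<lambda>_. 0) \<in> \<F>"
    and add_mem: "\<And>f g. \<lbrakk>f \<in> \<F>; g \<in> \<F>\<rbrakk> \<Longrightarrow> (\<lambda>x. f x + g x) \<in> \<F>"
    and scale_mem: "\<And>f c. f \<in> \<F> \<Longrightarrow> (\<lambda>x. c * f x) \<in> \<F>"
    and energy_nonneg: "\<And>f. f \<in> \<F> \<Longrightarrow> \<E> f \<ge> 0"
    and norm_definite: "\<And>f. \<lbrakk>f \<in> \<F>; energy_norm m p \<E> f = 0\<rbrakk> \<Longrightarrow> AE x in m. f x = 0"
    and norm_scale: "\<And>f c. f \<in> \<F> \<Longrightarrow>
          energy_norm m p \<E> (\<lambda>x. c * f x) = \<bar>c\<bar> * energy_norm m p \<E> f"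
    and norm_triangle: "\<And>f g. \<lbrakk>f \<in> \<F>; g \<in> \<F>\<rbrakk> \<Longrightarrow>
          energy_norm m p \<E> (\<lambda>x. f x + g x) \<le> energy_norm m p \<E> f + energy_norm m p \<E> g"
    and norm_complete: "\<And>f :: nat \<Rightarrow> 'a \<Rightarrow> real.
          \<lbrakk>\<And>j. f j \<in> \<F>;
           \<And>e. e > 0 \<Longrightarrow> \<exists>N. \<forall>i\<ge>N. \<forall>j\<ge>N. energy_norm m p \<E> (\<lambda>x. f i x - f j x) < e\<rbrakk>
          \<Longrightarrow> \<exists>g\<in>\<F>. (\<lambda>j. energy_norm m p \<E> (\<lambda>x. f j x - g x)) \<longlonglongrightarrow> 0"
    and sets_energy: "\<And>f. f \<in> \<F> \<Longrightarrow> sets (\<Gamma> f) = sets borel"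
    and finite_energy: "\<And>f. f \<in> \<F> \<Longrightarrow> finite_measure (\<Gamma> f)"
    and total_energy: "\<And>f. f \<in> \<F> \<Longrightarrow> measure (\<Gamma> f) UNIV = \<E> f"
    and energy_scale: "\<And>f c A. \<lbrakk>f \<in> \<F>; A \<in> sets borel\<rbrakk> \<Longrightarrow>
          measure (\<Gamma> (\<lambda>x. c * f x)) A = \<bar>c\<bar> powr p * measure (\<Gamma> f) A"
    and energy_triangle: "\<And>f g A. \<lbrakk>f \<in> \<F>; g \<in> \<F>; A \<in> sets borel\<rbrakk> \<Longrightarrow>
          measure (\<Gamma> (\<lambda>x. f x + g x)) A powr (1 / p)
            \<le> measure (\<Gamma> f) A powr (1 / p) + measure (\<Gamma> g) A powr (1 / p)"
    and contraction: "\<And>f g L. \<lbrakk>f \<in> \<F>; L-lipschitz_on UNIV g; g 0 = 0\<rbrakk> \<Longrightarrow>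
          (\<lambda>x. g (f x)) \<in> \<F> \<and>
          (\<forall>A \<in> sets borel. measure (\<Gamma> (\<lambda>x. g (f x))) A \<le> LIP g powr p * measure (\<Gamma> f) A)"
    and local_energy: "\<And>f A c. \<lbrakk>f \<in> \<F>; open A; AE x in m. x \<in> A \<longrightarrow> f x = c\<rbrakk> \<Longrightarrow> measure (\<Gamma> f) A = 0"
    and lower_semicontinuous: "\<And>(f :: nat \<Rightarrow> 'a \<Rightarrow> real) g.
          \<lbrakk>g \<in> real_lp_fun m p; \<And>j. f j \<in> \<F>;
           (\<lambda>j. lp_norm_vec m p (\<lambda>x. f j x - g x)) \<longlonglongrightarrow> 0;
           bdd_above (range (\<lambda>j. \<E> (f j)))\<rbrakk>
          \<Longrightarrow> g \<in> \<F> \<and>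
             (\<forall>A \<in> sets borel. emeasure (\<Gamma> g) A \<le> liminf (\<lambda>j. emeasure (\<Gamma> (f j)) A))"
    and dense_energy: "\<And>f e. \<lbrakk>f \<in> \<F>; e > 0\<rbrakk> \<Longrightarrow>
          \<exists>g \<in> C\<^sub>c \<inter> \<F>. energy_norm m p \<E> (\<lambda>x. f x - g x) < e"
    and dense_sup: "\<And>(f :: 'a \<Rightarrow> real) e. \<lbrakk>f \<in> C\<^sub>c; e > 0\<rbrakk> \<Longrightarrow>
          \<exists>g \<in> C\<^sub>c \<inter> \<F>. (SUP x. \<bar>f x - g x\<bar>) < e"

definition volume_doubling :: "'a::metric_space measure \<Rightarrow> bool" where
  "volume_doubling m \<longleftrightarrow>
    (\<exists>C>1. \<forall>x. \<forall>r>0.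
       0 < emeasure m (ball x (2 * r)) \<and>
       emeasure m (ball x (2 * r)) \<le> ennreal C * emeasure m (ball x r) \<and>
       ennreal C * emeasure m (ball x r) < \<infinity>)"

definition scale_function :: "(real \<Rightarrow> real) \<Rightarrow> bool" where
  "scale_function \<Psi> \<longleftrightarrow>
    continuous_on {0<..} \<Psi> \<and> strict_mono_on {0<..} \<Psi> \<and> bij_betw \<Psi> {0<..} {0<..} \<and>
    (\<exists>C\<ge>1. \<exists>b1>0. \<exists>b2>0. \<forall>r R. 0 < r \<and> r \<le> R \<longrightarrow>
       inverse C * (R / r) powr b1 \<le> \<Psi> R / \<Psi> r \<and> \<Psi> R / \<Psi> r \<le> C * (R / r) powr b2)"

definition average :: "'a measure \<Rightarrow> 'a set \<Rightarrow> ('a \<Rightarrow> real) \<Rightarrow> real" where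
  "average m B u = (LINT y:B|m. u y) / measure m B"

definition poincare_inequality ::
    "real \<Rightarrow> (real \<Rightarrow> real) \<Rightarrow> 'a::metric_space measure \<Rightarrow> ('a \<Rightarrow> real) set \<Rightarrow>
     (('a \<Rightarrow> real) \<Rightarrow> 'a measure) \<Rightarrow> bool" where
  "poincare_inequality p \<Psi> m \<F> \<Gamma> \<longleftrightarrow>
    (\<exists>C>0. \<exists>A\<ge>1. \<forall>x. \<forall>r>0. \<forall>u\<in>\<F>.
       (\<integral>\<^sup>+ y \<in> ball x r. ennreal (\<bar>u y - average m (ball x r) u\<bar> powr p) \<partial>m)
         \<le> ennreal (C * \<Psi> r) * emeasure (\<Gamma> u) (ball x (A * r)))"


section \<open>Curves and modulus\<close>

text \<open>A curve is a pair of a parameter interval and a function of which only the values on this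
  interval matter.\<close>

type_synonym 'a curve = "real set \<times> (real \<Rightarrow> 'a)"

definition curves :: "'a::metric_space curve set" where
  "curves = {(I, \<gamma>). is_interval I \<and> continuous_on I \<gamma> \<and> (\<exists>s\<in>I. \<exists>t\<in>I. \<gamma> s \<noteq> \<gamma> t)}"

definition curve_length :: "(real \<Rightarrow> 'a::metric_space) \<Rightarrow> real \<Rightarrow> real \<Rightarrow> ennreal" where
  "curve_length \<gamma> a b =
    (SUP (n, t) \<in> {(n :: nat, t :: nat \<Rightarrow> real). mono t \<and> range t \<subseteq> {a..b}}.
       \<Sum>i<n. ennreal (dist (\<gamma> (t i)) (\<gamma> (t (Suc i)))))"

definition locally_rectifiable :: "'a::metric_space curve \<Rightarrow> bool" where
  "locally_rectifiable = (\<lambda>(I, \<gamma>). \<forall>a\<in>I. \<forall>b\<in>I. curve_length \<gamma> a b < \<infinity>)"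

text \<open>The choice of the parameter is irrelevant when \<open>\<gamma>\<close> is continuous and of finite length on
  $[a,b]$: then each $s$ between 0 and the length is attained, and \<open>\<gamma>\<close> is constant on the set
  where it is attained.\<close>

definition arc_length_param :: "(real \<Rightarrow> 'a::metric_space) \<Rightarrow> real \<Rightarrow> real \<Rightarrow> real \<Rightarrow> 'a" where
  "arc_length_param \<gamma> a b s = \<gamma> (SOME t. t \<in> {a..b} \<and> curve_length \<gamma> a t = ennreal s)"

definition segment_integral ::
    "('a::metric_space \<Rightarrow> ennreal) \<Rightarrow> (real \<Rightarrow> 'a) \<Rightarrow> real \<Rightarrow> real \<Rightarrow> ennreal" where
  "segment_integral \<rho> \<gamma> a b =
    (\<integral>\<^sup>+ s \<in> {0..enn2real (curve_length \<gamma> a b)}. \<rho> (arc_length_param \<gamma> a b s) \<partial>lborel)"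

text \<open>For a locally rectifiable curve on an arbitrary interval, the line integral is the supremum
  over compact subintervals; on a compact interval this is the integral over the whole interval.\<close>

definition line_integral :: "('a::metric_space \<Rightarrow> ennreal) \<Rightarrow> 'a curve \<Rightarrow> ennreal" where
  "line_integral \<rho> = (\<lambda>(I, \<gamma>). SUP (a, b) \<in> {(a, b). a \<in> I \<and> b \<in> I \<and> a \<le> b}. segment_integral \<rho> \<gamma> a b)"

definition admissible :: "'a::metric_space curve set \<Rightarrow> ('a \<Rightarrow> ennreal) \<Rightarrow> bool" where
  "admissible \<C> \<rho> \<longleftrightarrow> \<rho> \<in> borel_measurable borel \<and>
    (\<forall>c\<in>\<C>. locally_rectifiable c \<longrightarrow> line_integral \<rho> c \<ge> 1)"

definition modulus :: "'a::metric_space measure \<Rightarrow> real \<Rightarrow> 'a curve set \<Rightarrow> ennreal" where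
  "modulus m p \<C> = (INF \<rho> \<in> {\<rho>. admissible \<C> \<rho>}. \<integral>\<^sup>+ x. enn_powr (\<rho> x) p \<partial>m)"


section \<open>Newtonian spaces\<close>

definition weak_upper_gradient ::
    "'a::metric_space measure \<Rightarrow> real \<Rightarrow> ('a \<Rightarrow> 'v::real_normed_vector) \<Rightarrow> ('a \<Rightarrow> ennreal) \<Rightarrow> bool" where
  "weak_upper_gradient m p u \<rho> \<longleftrightarrow> \<rho> \<in> borel_measurable borel \<and>
    (\<exists>\<C>\<subseteq>curves. modulus m p \<C> = 0 \<and>
      (\<forall>a b \<gamma>. ({a..b}, \<gamma>) \<in> curves - \<C> \<and> curve_length \<gamma> a b < \<infinity> \<longrightarrow>
         ennreal (norm (u (\<gamma> a) - u (\<gamma> b))) \<le> line_integral \<rho> ({a..b}, \<gamma>)))"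

definition newtonian_fun ::
    "'a::metric_space measure \<Rightarrow> real \<Rightarrow> ('a \<Rightarrow> 'v::real_normed_vector) set" where
  "newtonian_fun m p =
    {u \<in> bochner_lp_fun m p. \<exists>\<rho>. weak_upper_gradient m p u \<rho> \<and> lp_norm m p \<rho> < \<infinity>}"

definition newtonian_seminorm ::
    "'a::metric_space measure \<Rightarrow> real \<Rightarrow> ('a \<Rightarrow> 'v::real_normed_vector) \<Rightarrow> ennreal" where
  "newtonian_seminorm m p u =
    lp_norm_vec m p u + (INF \<rho> \<in> {\<rho>. weak_upper_gradient m p u \<rho>}. lp_norm m p \<rho>)"

definition newtonian_rel ::
    "'a::metric_space measure \<Rightarrow> real \<Rightarrow> (('a \<Rightarrow> 'v::real_normed_vector) \<times> ('a \<Rightarrow> 'v)) set" where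
  "newtonian_rel m p =
    {(u, v). u \<in> newtonian_fun m p \<and> v \<in> newtonian_fun m p \<and>
       newtonian_seminorm m p (\<lambda>x. u x - v x) = 0}"

definition newtonian_space ::
    "'a::metric_space measure \<Rightarrow> real \<Rightarrow> ('a \<Rightarrow> 'v::real_normed_vector) set set" where
  "newtonian_space m p = newtonian_fun m p // newtonian_rel m p"

lemma newtonian_seminorm_zero:
  fixes m :: "'a::metric_space measure"
  shows "newtonian_seminorm m p (\<lambda>x. 0 :: 'v::real_normed_vector) = 0"
proof -
  have norm0: "lp_norm m p (\<lambda>_::'a. 0) = 0"
    by (simp add: lp_norm_def enn_powr_def)
  have "modulus m p ({} :: 'a curve set) \<le> (\<integral>\<^sup>+ x. enn_powr 0 p \<partial>m)"
    unfolding modulus_def by (rule INF_lower) (simp add: admissible_def)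
  then have "modulus m p ({} :: 'a curve set) = 0"
    by (simp add: enn_powr_def)
  then have "weak_upper_gradient m p (\<lambda>x. 0 :: 'v) (\<lambda>_. 0)"
    unfolding weak_upper_gradient_def by (intro conjI exI[of _ "{}"]) auto
  then have "(INF \<rho> \<in> {\<rho>. weak_upper_gradient m p (\<lambda>x. 0 :: 'v) \<rho>}. lp_norm m p \<rho>) \<le> lp_norm m p (\<lambda>_. 0)"
    by (intro INF_lower) simp
  then show ?thesis
    by (simp add: newtonian_seminorm_def norm0)
qed

text \<open>Equality of the two quotients says that every \<open>p\<close>-integrable function is a Newtonian function
  and that both spaces make the same identifications.\<close>

lemma newtonian_space_eq_bochner_lp_space_iff:
  fixes m :: "'a::metric_space measure"
  shows "newtonian_space m p = (bochner_lp_space m p :: ('a \<Rightarrow> 'v::real_normed_vector) set set) \<longleftrightarrow>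
    (\<forall>u :: 'a \<Rightarrow> 'v. u \<in> bochner_lp_fun m p \<longrightarrow> u \<in> newtonian_fun m p) \<and>
    (\<forall>u \<in> bochner_lp_fun m p. \<forall>v :: 'a \<Rightarrow> 'v. v \<in> bochner_lp_fun m p \<longrightarrow>
       (newtonian_seminorm m p (\<lambda>x. u x - v x) = 0 \<longleftrightarrow> (AE x in m. u x = v x)))"
    (is "?L \<longleftrightarrow> ?R")
proof
  let ?N = "newtonian_fun m p :: ('a \<Rightarrow> 'v) set" and ?B = "bochner_lp_fun m p :: ('a \<Rightarrow> 'v) set"
  let ?r = "newtonian_rel m p :: (('a \<Rightarrow> 'v) \<times> _) set" and ?s = "bochner_lp_rel m p :: (('a \<Rightarrow> 'v) \<times> _) set"
  have r_iff: "(u, v) \<in> ?r \<longleftrightarrow> u \<in> ?N \<and> v \<in> ?N \<and> newtonian_seminorm m p (\<lambda>x. u x - v x) = 0" for u v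
    by (simp add: newtonian_rel_def)
  have s_iff: "(u, v) \<in> ?s \<longleftrightarrow> u \<in> ?B \<and> v \<in> ?B \<and> (AE x in m. u x = v x)" for u v
    by (simp add: bochner_lp_rel_def)
  have r_refl: "u \<in> ?r `` {u}" if "u \<in> ?N" for u
    using that newtonian_seminorm_zero by (simp add: r_iff)
  have s_equiv: "equiv ?B ?s"
  proof (rule equivI)
    show "?s \<subseteq> ?B \<times> ?B" "refl_on ?B ?s"
      by (auto simp: bochner_lp_rel_def refl_on_def)
    show "sym ?s"
    proof (rule symI)
      fix u v assume "(u, v) \<in> ?s"
      then show "(v, u) \<in> ?s"
        unfolding s_iff by (simp add: eq_commute)
    qed
    show "trans ?s"
    proof (rule transI)
      fix u v w assume uv: "(u, v) \<in> ?s" and vw: "(v, w) \<in> ?s"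
      from uv vw have "AE x in m. u x = v x" "AE x in m. v x = w x"
        unfolding s_iff by simp_all
      then have "AE x in m. u x = w x"
        by eventually_elim simp
      with uv vw show "(u, w) \<in> ?s"
        unfolding s_iff by simp
    qed
  qed
  have N_sub: "?N \<subseteq> ?B"
    by (auto simp: newtonian_fun_def)
  show ?R if ?L
  proof -
    from that have eq: "?N // ?r = ?B // ?s"
      by (simp only: newtonian_space_def bochner_lp_space_def)
    have cls_sub: "?r `` {u} \<subseteq> ?N" for u
      by (auto simp: newtonian_rel_def)
    have "?B \<subseteq> ?N"
    proof
      fix u assume u: "u \<in> ?B"
      then have "?s `` {u} \<in> ?N // ?r"
        unfolding eq by (rule quotientI)
      then obtain w where "?s `` {u} = ?r `` {w}"
        by (rule quotientE)
      moreover have "u \<in> ?s `` {u}"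
        using s_equiv u by (rule equiv_class_self)
      ultimately show "u \<in> ?N"
        using cls_sub[of w] by (simp only: subsetD)
    qed
    with N_sub have NB: "?N = ?B" by simp
    have cls: "?r `` {u} = ?s `` {u}" if u: "u \<in> ?B" for u
    proof -
      have "?r `` {u} \<in> ?B // ?s"
        unfolding eq[symmetric] using u unfolding NB[symmetric] by (rule quotientI)
      then obtain w where w: "?r `` {u} = ?s `` {w}"
        by (rule quotientE)
      have "u \<in> ?r `` {u}"
        using u by (intro r_refl) (simp only: NB)
      then have "(w, u) \<in> ?s"
        by (simp only: w Image_singleton_iff)
      then show ?thesis
        unfolding w by (rule equiv_class_eq[OF s_equiv])
    qed
    have rel: "(u, v) \<in> ?r \<longleftrightarrow> (u, v) \<in> ?s" if "u \<in> ?B" for u v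
      using cls[OF that] by (simp only: Image_singleton_iff[symmetric])
    show ?R
    proof (intro conjI allI impI ballI)
      fix u v assume "u \<in> ?B" "v \<in> ?B"
      then show "newtonian_seminorm m p (\<lambda>x. u x - v x) = 0 \<longleftrightarrow> (AE x in m. u x = v x)"
        using rel[of u v] unfolding r_iff s_iff NB by simp
    qed (simp add: NB)
  qed
  show ?L if R: ?R
  proof -
    have "?B \<subseteq> ?N"
      using R by (intro subsetI) simp
    with N_sub have NB: "?N = ?B" by simp
    have "(u, v) \<in> ?r \<longleftrightarrow> (u, v) \<in> ?s" for u v
    proof (cases "u \<in> ?B \<and> v \<in> ?B")
      case True
      with R have "newtonian_seminorm m p (\<lambda>x. u x - v x) = 0 \<longleftrightarrow> (AE x in m. u x = v x)"
        by blast
      with True show ?thesis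
        unfolding r_iff s_iff NB by simp
    next
      case False
      then show ?thesis
        unfolding r_iff s_iff NB by blast
    qed
    then have "?r = ?s"
      by (intro set_eqI) (simp only: split_paired_all)
    then show ?L
      by (simp only: newtonian_space_def bochner_lp_space_def NB)
  qed
qed

end

theory Submission
  imports Defs
begin

text \<open>The family of all curves has modulus zero, so \<open>0\<close> is a \<open>p\<close>-weak upper gradient of every
  function. To see this, let $u \in C_c(X) \cap \mathcal{F}_p$ and consider the averages of \<open>u\<close>
  over the balls of radius \<open>R\<close> centred on a curve. By the Poincare inequality they change by at most
  $\frac{R}{4} h(w)^{1/p}$ within distance $R/2$ of \<open>w\<close>, where \<open>h(w)\<close> is a constant multiple of
  $\frac{\Psi(R)}{R^p} \cdot \frac{\Gamma_p\langle u\rangle(B(w, 2AR))}{m(B(w, R/2))}$. Hence the line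
  integral of $h^{1/p}$ bounds the difference of the averages at the end points, which tends to the
  difference of the values of \<open>u\<close> as \<open>R\<close> tends to 0, whereas by Fubini and doubling the
  integral of \<open>h\<close> is at most a multiple of $\Psi(R)/R^p \cdot \mathcal{E}_p(u)$ and is
  arbitrarily small for suitable \<open>R\<close>, even after multiplying $h^{1/p}$ by any
  given \<open>N\<close>. A sum over countably many \<open>u\<close> separating points and over $N = 1, 2, \dots$
  then gives a density of small norm that is admissible for all curves.\<close>

section \<open>Powers of extended non-negative numbers\<close>

lemma enn_powr_ennreal: "0 \<le> t \<Longrightarrow> enn_powr (ennreal t) a = ennreal (t powr a)"
  by (simp add: enn_powr_def)

lemma enn_powr_zero [simp]: "enn_powr 0 a = 0"
  by (simp add: enn_powr_def)

lemma enn_powr_mono: "x \<le> y \<Longrightarrow> 0 \<le> a \<Longrightarrow> enn_powr x a \<le> enn_powr y a"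
  by (auto simp: enn_powr_def top_unique less_top intro!: ennreal_leI powr_mono2 enn2real_mono)

lemma enn_powr_inverse:
  assumes "a > 0"
  shows "enn_powr (enn_powr x a) (1 / a) = x" and "enn_powr (enn_powr x (1 / a)) a = x"
  using assms by (auto simp: enn_powr_def powr_powr less_top)

text \<open>True for every real exponent, because \<open>powr\<close> gives 0 on base 0 whatever the
  exponent, and infinity is sent to itself.\<close>

lemma enn_powr_eq_zero_iff: "enn_powr x a = 0 \<longleftrightarrow> x = 0"
  by (auto simp: enn_powr_def enn2real_eq_0_iff)

lemma borel_measurable_enn_powr [measurable]: "(\<lambda>x. enn_powr x a) \<in> borel_measurable borel"
  unfolding enn_powr_def by measurable

section \<open>Length of curves\<close>

text \<open>Real-valued form of the sums in \<open>curve_length\<close>, so that limits and real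
  inequalities can be used before passing to \<open>ennreal\<close>.\<close>

definition variation_sum :: "(real \<Rightarrow> 'a::metric_space) \<Rightarrow> nat \<Rightarrow> (nat \<Rightarrow> real) \<Rightarrow> real" where
  "variation_sum \<gamma> n t = (\<Sum>i<n. dist (\<gamma> (t i)) (\<gamma> (t (Suc i))))"

lemma variation_sum_nonneg [simp]: "0 \<le> variation_sum \<gamma> n t"
  by (simp add: variation_sum_def sum_nonneg)

lemma curve_length_eq_SUP_variation_sum:
  "curve_length \<gamma> a b =
    (SUP (n, t) \<in> {(n, t). mono t \<and> range t \<subseteq> {a..b}}. ennreal (variation_sum \<gamma> n t))"
  unfolding curve_length_def variation_sum_def by (simp add: sum_ennreal)

lemma variation_sum_le_curve_length:
  assumes "mono t" "\<And>i. t i \<in> {a..b}"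
  shows "ennreal (variation_sum \<gamma> n t) \<le> curve_length \<gamma> a b"
  unfolding curve_length_eq_SUP_variation_sum using assms by (intro SUP_upper2[of "(n, t)"]) auto

lemma curve_length_leI:
  assumes "\<And>n t. \<lbrakk>mono t; \<And>i. t i \<in> {a..b}\<rbrakk> \<Longrightarrow> ennreal (variation_sum \<gamma> n t) \<le> c"
  shows "curve_length \<gamma> a b \<le> c"
  unfolding curve_length_eq_SUP_variation_sum
  by (rule SUP_least) (use assms in \<open>auto simp: image_subset_iff\<close>)

lemma less_curve_lengthD:
  assumes "c < curve_length \<gamma> a b"
  shows "\<exists>t n. mono t \<and> (\<forall>i. t i \<in> {a..b}) \<and> c < ennreal (variation_sum \<gamma> n t)"
  using assms unfolding curve_length_eq_SUP_variation_sum less_SUP_iff by (auto simp: image_subset_iff)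

lemma curve_length_mono:
  assumes "a' \<le> a" "b \<le> b'"
  shows "curve_length \<gamma> a b \<le> curve_length \<gamma> a' b'"
  by (rule curve_length_leI, rule variation_sum_le_curve_length) (use assms in \<open>auto intro: order_trans\<close>)

lemma dist_le_curve_length:
  assumes "a \<le> b"
  shows "ennreal (dist (\<gamma> a) (\<gamma> b)) \<le> curve_length \<gamma> a b"
proof -
  define t where "t = (\<lambda>i::nat. if i = 0 then a else b)"
  have "ennreal (variation_sum \<gamma> 1 t) \<le> curve_length \<gamma> a b"
    using assms by (intro variation_sum_le_curve_length) (auto simp: t_def mono_def)
  then show ?thesis by (simp add: variation_sum_def t_def)
qed

lemma curve_length_refl [simp]: "curve_length \<gamma> a a = 0"
proof -
  have "curve_length \<gamma> a a \<le> 0"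
    by (rule curve_length_leI) (simp add: variation_sum_def)
  then show ?thesis by simp
qed

text \<open>Clamping a partition at \<open>x\<close> splits it into partitions of the two sides of \<open>x\<close>, and
  reduces the semicontinuity of the length to the continuity of \<open>\<gamma>\<close>.\<close>

lemma curve_length_subadditive:
  "curve_length \<gamma> a b \<le> curve_length \<gamma> a x + curve_length \<gamma> x b" if "x \<in> {a..b}"
proof (rule curve_length_leI)
  fix n and t :: "nat \<Rightarrow> real"
  assume t: "mono t" "\<And>i. t i \<in> {a..b}"
  have *: "dist (\<gamma> u) (\<gamma> v) \<le> dist (\<gamma> (min u x)) (\<gamma> (min v x)) + dist (\<gamma> (max u x)) (\<gamma> (max v x))"
    if "u \<le> v" for u v
    using that dist_triangle[of "\<gamma> u" "\<gamma> v" "\<gamma> x"] by (auto simp: min_def max_def)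
  have "variation_sum \<gamma> n t \<le> variation_sum \<gamma> n (\<lambda>i. min (t i) x) + variation_sum \<gamma> n (\<lambda>i. max (t i) x)"
    unfolding variation_sum_def sum.distrib[symmetric]
    by (intro sum_mono *) (use t in \<open>auto simp: mono_def\<close>)
  then have "ennreal (variation_sum \<gamma> n t) \<le>
      ennreal (variation_sum \<gamma> n (\<lambda>i. min (t i) x)) + ennreal (variation_sum \<gamma> n (\<lambda>i. max (t i) x))"
    by (simp add: ennreal_plus[symmetric] ennreal_leI del: ennreal_plus)
  also have "\<dots> \<le> curve_length \<gamma> a x + curve_length \<gamma> x b"
    using t(2) that
    by (intro add_mono variation_sum_le_curve_length monoI min.mono max.mono monoD[OF t(1)])
      (auto simp: min_le_iff_disj le_max_iff_disj)
  finally show "ennreal (variation_sum \<gamma> n t) \<le> curve_length \<gamma> a x + curve_length \<gamma> x b" .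
qed

text \<open>Concatenating a partition of [a,x] with one of [x,b] loses nothing of the two sums; the
  suprema over both are then taken one after the other.\<close>

lemma curve_length_superadditive:
  "curve_length \<gamma> a x + curve_length \<gamma> x b \<le> curve_length \<gamma> a b" if "x \<in> {a..b}"
proof -
  have *: "ennreal (variation_sum \<gamma> n s) + ennreal (variation_sum \<gamma> k t) \<le> curve_length \<gamma> a b"
    if s: "mono s" "\<And>i. s i \<in> {a..x}" and t: "mono t" "\<And>i. t i \<in> {x..b}" for n s k t
  proof -
    \<comment> \<open>The points \<open>s 0\<close>, ..., \<open>s n\<close> are followed by
      \<open>t 0\<close>, \<open>t 1\<close>, ..., hence the shift by \<open>Suc n\<close>. The
      extra step from \<open>s n\<close> to \<open>t 0\<close> only adds a non-negative
      term.\<close>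
    define w where "w = (\<lambda>i. if i \<le> n then s i else t (i - Suc n))"
    have w: "mono w"
      unfolding w_def mono_def
    proof (intro allI impI)
      fix i j :: nat assume "i \<le> j"
      moreover have "s i \<le> t l" for l
        using s(2)[of i] t(2)[of l] by simp
      ultimately show "(if i \<le> n then s i else t (i - Suc n)) \<le> (if j \<le> n then s j else t (j - Suc n))"
        using s(1) t(1) by (auto intro!: monoD[OF s(1)] monoD[OF t(1)])
    qed
    have "variation_sum \<gamma> n s + variation_sum \<gamma> k t \<le> variation_sum \<gamma> (Suc n + k) w"
    proof (induction k)
      case 0
      then show ?case by (simp add: variation_sum_def w_def)
    next
      case (Suc k)
      then show ?case by (simp add: variation_sum_def) (simp add: w_def)
    qed
    then have "ennreal (variation_sum \<gamma> n s) + ennreal (variation_sum \<gamma> k t) \<le> ennreal (variation_sum \<gamma> (Suc n + k) w)"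
      by (simp add: ennreal_plus[symmetric] ennreal_leI del: ennreal_plus)
    also have "\<dots> \<le> curve_length \<gamma> a b"
      using \<open>x \<in> {a..b}\<close> s(2) t(2) w by (intro variation_sum_le_curve_length) (auto simp: w_def intro: order_trans)
    finally show ?thesis .
  qed
  let ?P = "\<lambda>a b. {(n::nat, t::nat \<Rightarrow> real). mono t \<and> range t \<subseteq> {a..b}}"
  \<comment> \<open>Adding a constant commutes with a supremum in \<open>ennreal\<close> over a
    nonempty index set; the constant partition at \<open>x\<close> belongs to both sets.\<close>
  have ne: "?P a x \<noteq> {}" "?P x b \<noteq> {}"
    using that by (auto intro!: exI[of _ "\<lambda>_. x"] simp: mono_def)
  have "curve_length \<gamma> a x + curve_length \<gamma> x b =
      (SUP (k, t) \<in> ?P x b. SUP (n, s) \<in> ?P a x.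
        ennreal (variation_sum \<gamma> n s) + ennreal (variation_sum \<gamma> k t))"
    unfolding curve_length_eq_SUP_variation_sum case_prod_unfold
      ennreal_SUP_add_left[OF ne(1)[unfolded case_prod_unfold], symmetric]
      ennreal_SUP_add_right[OF ne(2)[unfolded case_prod_unfold]] ..
  also have "\<dots> \<le> curve_length \<gamma> a b"
    by (intro SUP_least) (auto intro!: SUP_least *)
  finally show ?thesis .
qed

text \<open>Rules out a jump of the length from \<open>a\<close> when its end point increases to
  \<open>x\<close>. The mirror image that follows rules out a jump just after \<open>x\<close>, by
  way of the length of the remaining piece.\<close>

lemma curve_length_left_lsc:
  assumes "continuous_on {a..b} \<gamma>" "a < x" "x \<le> b" "c < curve_length \<gamma> a x"
  shows "\<exists>y. a \<le> y \<and> y < x \<and> c < curve_length \<gamma> a y"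
proof -
  obtain t n where t: "mono t" "\<And>i. t i \<in> {a..x}" "c < ennreal (variation_sum \<gamma> n t)"
    using less_curve_lengthD[OF assms(4)] by blast
  have ev: "\<forall>\<^sub>F y in at_left x. y \<in> {a<..<x}"
    using assms(2) by (rule eventually_at_left_real)
  have "((\<lambda>y. \<gamma> (min (t i) y)) \<longlongrightarrow> \<gamma> (min (t i) x)) (at_left x)" for i
    using t(2)[of i] assms(2,3)
    by (intro continuous_on_tendsto_compose[OF assms(1)] tendsto_intros eventually_mono[OF ev]) auto
  then have "((\<lambda>y. variation_sum \<gamma> n (\<lambda>i. min (t i) y)) \<longlongrightarrow> variation_sum \<gamma> n (\<lambda>i. min (t i) x)) (at_left x)"
    unfolding variation_sum_def by (intro tendsto_intros)
  moreover have "(\<lambda>i. min (t i) x) = t"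
    using t(2) by (auto simp: min_absorb1)
  ultimately have "((\<lambda>y. ennreal (variation_sum \<gamma> n (\<lambda>i. min (t i) y))) \<longlongrightarrow> ennreal (variation_sum \<gamma> n t)) (at_left x)"
    by (auto intro: tendsto_ennrealI)
  from order_tendstoD(1)[OF this t(3)] ev
  have "\<forall>\<^sub>F y in at_left x. c < ennreal (variation_sum \<gamma> n (\<lambda>i. min (t i) y)) \<and> y \<in> {a<..<x}"
    by eventually_elim simp
  then obtain y where y: "c < ennreal (variation_sum \<gamma> n (\<lambda>i. min (t i) y))" "y \<in> {a<..<x}"
    using eventually_happens trivial_limit_at_left_real by blast
  have "ennreal (variation_sum \<gamma> n (\<lambda>i. min (t i) y)) \<le> curve_length \<gamma> a y"
    using t(2) y(2) by (intro variation_sum_le_curve_length monoI min.mono monoD[OF t(1)])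
      (auto simp: min_le_iff_disj)
  with y(1) have "c < curve_length \<gamma> a y" by (rule less_le_trans)
  with y(2) show ?thesis by (intro exI[of _ y]) simp
qed

lemma curve_length_right_lsc:
  assumes "continuous_on {a..b} \<gamma>" "a \<le> x" "x < b" "c < curve_length \<gamma> x b"
  shows "\<exists>y. x < y \<and> y \<le> b \<and> c < curve_length \<gamma> y b"
proof -
  obtain t n where t: "mono t" "\<And>i. t i \<in> {x..b}" "c < ennreal (variation_sum \<gamma> n t)"
    using less_curve_lengthD[OF assms(4)] by blast
  have ev: "\<forall>\<^sub>F y in at_right x. y \<in> {x<..<b}"
    using assms(3) by (rule eventually_at_right_real)
  have "((\<lambda>y. \<gamma> (max (t i) y)) \<longlongrightarrow> \<gamma> (max (t i) x)) (at_right x)" for i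
    using t(2)[of i] assms(2,3)
    by (intro continuous_on_tendsto_compose[OF assms(1)] tendsto_intros eventually_mono[OF ev]) auto
  then have "((\<lambda>y. variation_sum \<gamma> n (\<lambda>i. max (t i) y)) \<longlongrightarrow> variation_sum \<gamma> n (\<lambda>i. max (t i) x)) (at_right x)"
    unfolding variation_sum_def by (intro tendsto_intros)
  moreover have "(\<lambda>i. max (t i) x) = t"
    using t(2) by (auto simp: max_absorb1)
  ultimately have "((\<lambda>y. ennreal (variation_sum \<gamma> n (\<lambda>i. max (t i) y))) \<longlongrightarrow> ennreal (variation_sum \<gamma> n t)) (at_right x)"
    by (auto intro: tendsto_ennrealI)
  from order_tendstoD(1)[OF this t(3)] ev
  have "\<forall>\<^sub>F y in at_right x. c < ennreal (variation_sum \<gamma> n (\<lambda>i. max (t i) y)) \<and> y \<in> {x<..<b}"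
    by eventually_elim simp
  then obtain y where y: "c < ennreal (variation_sum \<gamma> n (\<lambda>i. max (t i) y))" "y \<in> {x<..<b}"
    using eventually_happens trivial_limit_at_right_real by blast
  have "ennreal (variation_sum \<gamma> n (\<lambda>i. max (t i) y)) \<le> curve_length \<gamma> y b"
    using t(2) y(2) by (intro variation_sum_le_curve_length monoI max.mono monoD[OF t(1)])
      (auto simp: le_max_iff_disj)
  with y(1) have "c < curve_length \<gamma> y b" by (rule less_le_trans)
  with y(2) show ?thesis by (intro exI[of _ y]) simp
qed

text \<open>An intermediate value argument for the monotone function
  \<open>curve_length \<gamma> a\<close>: at the supremum \<open>x\<close> of the points where it is
  at most \<open>s\<close>, semicontinuity from the left gives one inequality, and semicontinuity
  from the right combined with additivity gives the other.\<close>

lemma curve_length_attained: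
  assumes cont: "continuous_on {a..b} \<gamma>" and "a \<le> b" and fin: "curve_length \<gamma> a b < \<infinity>"
    and s: "s \<le> curve_length \<gamma> a b"
  shows "\<exists>t\<in>{a..b}. curve_length \<gamma> a t = s"
proof -
  define T where "T = {t\<in>{a..b}. curve_length \<gamma> a t \<le> s}"
  define x where "x = Sup T"
  have aT: "a \<in> T" using \<open>a \<le> b\<close> by (simp add: T_def)
  have bdd: "bdd_above T" by (rule bdd_aboveI[of _ b]) (simp add: T_def)
  have ax: "a \<le> x" unfolding x_def using aT bdd by (rule cSup_upper)
  have xb: "x \<le> b" unfolding x_def using aT by (intro cSup_least) (auto simp: T_def)
  have below: "curve_length \<gamma> a y \<le> s" if "y < x" for y
  proof -
    obtain t where "t \<in> T" "y < t"
      using \<open>y < x\<close> aT unfolding x_def by (metis less_cSupE empty_iff)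
    then show ?thesis
      using curve_length_mono[of a a y t \<gamma>] by (auto simp: T_def intro: order_trans)
  qed
  have above: "s < curve_length \<gamma> a y" if "x < y" "y \<le> b" for y
  proof (rule ccontr)
    assume "\<not> s < curve_length \<gamma> a y"
    with that ax have "y \<in> T" by (auto simp: T_def)
    then have "y \<le> x" unfolding x_def using bdd by (intro cSup_upper)
    with that show False by simp
  qed
  have "curve_length \<gamma> a x \<le> s"
  proof (rule ccontr)
    assume "\<not> ?thesis"
    then have gt: "s < curve_length \<gamma> a x" by simp
    then have "a < x" using ax by (cases "a = x") auto
    from curve_length_left_lsc[OF cont this xb gt] below show False by (meson leD)
  qed
  moreover have "s \<le> curve_length \<gamma> a x"
  proof (rule ccontr)
    assume "\<not> ?thesis"
    then have lt: "curve_length \<gamma> a x < s" by simp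
    with s have "x < b" using xb by (cases "x = b") auto
    have split: "curve_length \<gamma> a y + curve_length \<gamma> y b = curve_length \<gamma> a b" if "y \<in> {a..b}" for y
      using that by (intro antisym curve_length_superadditive curve_length_subadditive)
    have fin': "curve_length \<gamma> y z < \<infinity>" if "a \<le> y" "z \<le> b" for y z
      using curve_length_mono[OF that] fin by (rule le_less_trans)
    have s_fin: "s < \<infinity>" using s fin by (rule le_less_trans)
    \<comment> \<open>If the length up to \<open>x\<close> fell short of \<open>s\<close>, the rest
      would be longer than the total minus \<open>s\<close>. This persists at some \<open>y\<close>
      beyond \<open>x\<close>, where by \<open>above\<close> the first piece is already longer than
      \<open>s\<close>, so the two pieces together would exceed the total.\<close>
    have ltW: "curve_length \<gamma> a b - s < curve_length \<gamma> x b"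
    proof -
      have "curve_length \<gamma> a x + curve_length \<gamma> x b < s + curve_length \<gamma> x b"
        using lt fin'[of x b] ax by (simp add: add.commute ennreal_add_left_cancel_less less_top)
      then have "curve_length \<gamma> a b < s + curve_length \<gamma> x b"
        using split[of x] ax xb by simp
      then show ?thesis
        using s s_fin by (simp add: minus_less_iff_ennreal less_top add.commute)
    qed
    then obtain y where y: "x < y" "y \<le> b" "curve_length \<gamma> a b - s < curve_length \<gamma> y b"
      using curve_length_right_lsc[OF cont ax \<open>x < b\<close>] by blast
    have "curve_length \<gamma> a b < s + curve_length \<gamma> y b"
      using y(3) s s_fin by (simp add: minus_less_iff_ennreal less_top add.commute)
    also have "\<dots> \<le> curve_length \<gamma> a y + curve_length \<gamma> y b"
      using above[OF y(1,2)] by (intro add_right_mono) simp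
    also have "\<dots> = curve_length \<gamma> a b" using ax y by (intro split) auto
    finally show False by simp
  qed
  ultimately show ?thesis using ax xb by (intro bexI[of _ x]) auto
qed

section \<open>Arc-length parametrisation and chaining along a curve\<close>

text \<open>By superadditivity two points of the curve are no further apart than the difference of
  their length values. This is the Lipschitz bound, and it also makes the arbitrary choice of a
  parameter with a given length value immaterial.\<close>

lemma arc_length_param_props:
  assumes cont: "continuous_on {a..b} \<gamma>" and "a \<le> b" and fin: "curve_length \<gamma> a b < \<infinity>"
  defines "L \<equiv> enn2real (curve_length \<gamma> a b)"
  shows "1-lipschitz_on {0..L} (arc_length_param \<gamma> a b)"
    and "arc_length_param \<gamma> a b 0 = \<gamma> a"
    and "arc_length_param \<gamma> a b L = \<gamma> b"
proof -
  have L: "ennreal L = curve_length \<gamma> a b" "L \<ge> 0"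
    using fin by (auto simp: L_def)
  have dist_le: "ennreal (dist (\<gamma> t) (\<gamma> t')) \<le> ennreal (s' - s)"
    if "t \<le> t'" "t \<in> {a..b}" "t' \<in> {a..b}" "curve_length \<gamma> a t = ennreal s" "curve_length \<gamma> a t' = ennreal s'"
       "0 \<le> s" "0 \<le> s'" for t t' s s'
  proof -
    have "ennreal s + ennreal (dist (\<gamma> t) (\<gamma> t')) \<le> curve_length \<gamma> a t + curve_length \<gamma> t t'"
      using that dist_le_curve_length by (intro add_mono) auto
    also have "\<dots> \<le> ennreal s'"
      using that curve_length_superadditive[of t a t' \<gamma>] by simp
    finally show ?thesis
      using that by (intro ennreal_leI) (simp add: ennreal_plus[symmetric] del: ennreal_plus)
  qed
  have close: "dist (\<gamma> t) (\<gamma> t') \<le> \<bar>s - s'\<bar>"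
    if "t \<in> {a..b}" "t' \<in> {a..b}" "curve_length \<gamma> a t = ennreal s" "curve_length \<gamma> a t' = ennreal s'"
       "0 \<le> s" "0 \<le> s'" for t t' s s'
  proof (cases "t \<le> t'")
    case True
    have le: "s \<le> s'" using curve_length_mono[of a a t t' \<gamma>] True that by simp
    with dist_le[OF True] that show ?thesis by (auto simp: ennreal_le_iff)
  next
    case False
    then have "t' \<le> t" by simp
    have le: "s' \<le> s" using curve_length_mono[of a a t' t \<gamma>] False that by simp
    with dist_le[OF \<open>t' \<le> t\<close>] that show ?thesis by (auto simp: ennreal_le_iff dist_commute)
  qed
  define \<tau> where "\<tau> s = (SOME t. t \<in> {a..b} \<and> curve_length \<gamma> a t = ennreal s)" for s
  have \<tau>: "\<tau> s \<in> {a..b} \<and> curve_length \<gamma> a (\<tau> s) = ennreal s" if "s \<in> {0..L}" for s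
  proof -
    have "ennreal s \<le> curve_length \<gamma> a b"
      unfolding L(1)[symmetric] using that by (simp add: ennreal_leI)
    from curve_length_attained[OF cont \<open>a \<le> b\<close> fin this] show ?thesis
      unfolding \<tau>_def by - (rule someI_ex, blast)
  qed
  have eq: "arc_length_param \<gamma> a b s = \<gamma> (\<tau> s)" for s
    by (simp add: arc_length_param_def \<tau>_def)
  show "1-lipschitz_on {0..L} (arc_length_param \<gamma> a b)"
  proof (rule lipschitz_onI)
    fix s s' assume "s \<in> {0..L}" "s' \<in> {0..L}"
    then show "dist (arc_length_param \<gamma> a b s) (arc_length_param \<gamma> a b s') \<le> 1 * dist s s'"
      using close[of "\<tau> s" "\<tau> s'" s s'] \<tau>[of s] \<tau>[of s'] by (simp add: eq dist_real_def)
  qed simp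
  \<comment> \<open>The chosen parameter \<open>\<tau> 0\<close> may differ from \<open>a\<close>,
    but both have length value 0, so \<open>close\<close> identifies their images. The other end
    point is treated alike.\<close>
  have "dist (\<gamma> (\<tau> 0)) (\<gamma> a) \<le> \<bar>0 - 0\<bar>"
    by (rule close) (use \<tau>[of 0] \<open>0 \<le> L\<close> \<open>a \<le> b\<close> in auto)
  then show "arc_length_param \<gamma> a b 0 = \<gamma> a"
    by (simp add: eq)
  have "dist (\<gamma> (\<tau> L)) (\<gamma> b) \<le> \<bar>L - L\<bar>"
    by (rule close[OF _ _ _ L(1)[symmetric]]) (use \<tau>[of L] \<open>0 \<le> L\<close> \<open>a \<le> b\<close> in auto)
  then show "arc_length_param \<gamma> a b L = \<gamma> b"
    by (simp add: eq)
qed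

text \<open>Cut [0,L] into equal pieces of length about \<delta>. On each piece the difference
  quotient of \<open>\<phi>\<close> along the end points is at most \<open>g (\<sigma> s)\<close>
  for every \<open>s\<close> in it, so a step function lies below the integrand, and its integral
  bounds the telescoping sum.\<close>

lemma abs_diff_le_nn_integral_chain:
  fixes \<sigma> :: "real \<Rightarrow> 'a::metric_space" and \<phi> :: "'a \<Rightarrow> real" and g :: "'a \<Rightarrow> ennreal"
  assumes lip: "1-lipschitz_on {0..L} \<sigma>" and \<delta>: "0 < \<delta>" "\<delta> \<le> L"
    and step: "\<And>z z' w. \<lbrakk>dist z w \<le> \<delta>; dist z' w \<le> \<delta>\<rbrakk>
      \<Longrightarrow> ennreal \<bar>\<phi> z - \<phi> z'\<bar> \<le> ennreal (\<delta> / 2) * g w"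
  shows "ennreal \<bar>\<phi> (\<sigma> 0) - \<phi> (\<sigma> L)\<bar> \<le> (\<integral>\<^sup>+ s \<in> {0..L}. g (\<sigma> s) \<partial>lborel)"
proof -
  \<comment> \<open>Rounding up puts the mesh \<open>h\<close> between \<delta>/2 and \<delta>: the
    upper bound keeps both end points of a piece within \<delta> of each of its points, the lower
    bound absorbs the factor \<delta>/2 of \<open>step\<close>.\<close>
  define N where "N = nat \<lceil>L / \<delta>\<rceil>"
  define h where "h = L / N"
  have "L / \<delta> \<ge> 1" using \<delta> by simp
  then have "0 < \<lceil>L / \<delta>\<rceil>" by linarith
  then have N: "real N = of_int \<lceil>L / \<delta>\<rceil>" "N > 0" by (auto simp: N_def)
  have N_bounds: "L / \<delta> \<le> N" "N \<le> 2 * (L / \<delta>)"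
    using \<open>L / \<delta> \<ge> 1\<close> unfolding N(1) by linarith+
  have h: "0 < h" "h \<le> \<delta>" "\<delta> / 2 \<le> h" "N * h = L"
    using N_bounds N(2) \<delta> by (auto simp: h_def field_simps)
  define J where "J i = {real i * h..<real (Suc i) * h}" for i
  define c where "c i = \<phi> (\<sigma> (real i * h))" for i
  define D where "D i = \<bar>c i - c (Suc i)\<bar> / h" for i
  have D_nonneg: "0 \<le> D i" for i using h(1) by (simp add: D_def)
  have in_range: "real i * h \<in> {0..L}" if "i \<le> N" for i
    using that h(1) unfolding h(4)[symmetric] by (auto intro: mult_right_mono)
  have D_le: "ennreal (D i) \<le> g (\<sigma> s)" if "i < N" "s \<in> J i" for i s
  proof -
    have "real (Suc i) * h \<le> L" using in_range[of "Suc i"] that by simp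
    moreover have "0 \<le> real i * h" using h(1) by simp
    ultimately have s: "s \<in> {0..L}" using that(2) unfolding J_def by simp
    have "dist (\<sigma> (real i * h)) (\<sigma> s) \<le> \<bar>real i * h - s\<bar>"
      using lipschitz_onD[OF lip in_range[of i] s] that by (simp add: dist_real_def)
    also have "\<dots> \<le> \<delta>" using that(2) h(2) by (auto simp: J_def algebra_simps)
    finally have d1: "dist (\<sigma> (real i * h)) (\<sigma> s) \<le> \<delta>" .
    have "dist (\<sigma> (real (Suc i) * h)) (\<sigma> s) \<le> \<bar>real (Suc i) * h - s\<bar>"
      using lipschitz_onD[OF lip in_range[of "Suc i"] s] that by (simp add: dist_real_def)
    also have "\<dots> \<le> \<delta>" using that(2) h(2) by (auto simp: J_def algebra_simps)
    finally have d2: "dist (\<sigma> (real (Suc i) * h)) (\<sigma> s) \<le> \<delta>" .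
    have "ennreal (D i) * ennreal h = ennreal \<bar>c i - c (Suc i)\<bar>"
      using h(1) D_nonneg by (simp add: D_def ennreal_mult[symmetric])
    also have "\<dots> \<le> ennreal (\<delta> / 2) * g (\<sigma> s)"
      unfolding c_def by (rule step[OF d1 d2])
    also have "\<dots> \<le> ennreal h * g (\<sigma> s)"
      using h(3) by (intro mult_right_mono ennreal_leI) auto
    finally have "ennreal h * ennreal (D i) \<le> ennreal h * g (\<sigma> s)"
      by (simp add: mult.commute)
    then show ?thesis
      using h(1) by (simp add: ennreal_mult_le_mult_iff)
  qed
  have disj: "disjoint_family_on J {..<N}"
  unfolding disjoint_family_on_def
  proof (intro ballI impI)
    fix i j :: nat assume "i \<noteq> j"
    show "J i \<inter> J j = {}"
    proof (rule ccontr)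
      assume "J i \<inter> J j \<noteq> {}"
      then obtain s where s: "s \<in> J i" "s \<in> J j" by blast
      have "real i * h < real (Suc j) * h" "real j * h < real (Suc i) * h"
        using s unfolding J_def by auto
      then have "i < Suc j" "j < Suc i"
        using h(1) by (simp_all only: mult_less_cancel_right_pos of_nat_less_iff)
      with \<open>i \<noteq> j\<close> show False by simp
    qed
  qed
  have J_sub: "s \<in> {0..L}" if "i < N" "s \<in> J i" for i s
  proof -
    have "real (Suc i) * h \<le> L" using in_range[of "Suc i"] that by simp
    moreover have "0 \<le> real i * h" using h(1) by simp
    ultimately show "s \<in> {0..L}" using that(2) unfolding J_def by simp
  qed
  have pointwise: "(\<Sum>i<N. ennreal (D i) * indicator (J i) s) \<le> g (\<sigma> s) * indicator {0..L} s" for s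
  proof (cases "\<exists>i<N. s \<in> J i")
    case True
    then obtain i where i: "i < N" "s \<in> J i" by blast
    have "(\<Sum>j<N. ennreal (D j) * indicator (J j) s) = (\<Sum>j\<in>{i}. ennreal (D j) * indicator (J j) s)"
      using i disj by (intro sum.mono_neutral_right) (auto simp: disjoint_family_on_def indicator_def)
    then show ?thesis using D_le[OF i] J_sub[OF i] i by simp
  next
    case False
    then show ?thesis by (simp add: indicator_def)
  qed
  have "\<bar>\<phi> (\<sigma> 0) - \<phi> (\<sigma> L)\<bar> = \<bar>\<Sum>i<N. c (Suc i) - c i\<bar>"
    unfolding sum_lessThan_telescope[of c N] by (simp add: c_def h(4) abs_minus_commute)
  also have "\<dots> \<le> (\<Sum>i<N. \<bar>c i - c (Suc i)\<bar>)"
    by (rule order_trans[OF sum_abs]) (simp add: abs_minus_commute)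
  also have "\<dots> = (\<Sum>i<N. D i * h)"
    using h(1) by (simp add: D_def)
  finally have "ennreal \<bar>\<phi> (\<sigma> 0) - \<phi> (\<sigma> L)\<bar> \<le> ennreal (\<Sum>i<N. D i * h)"
    by (rule ennreal_leI)
  also have "\<dots> = (\<Sum>i<N. ennreal (D i) * ennreal h)"
    using D_nonneg h(1) by (simp add: sum_ennreal[symmetric] ennreal_mult)
  also have "\<dots> = (\<Sum>i<N. ennreal (D i) * emeasure lborel (J i))"
    using h(1) by (simp add: J_def algebra_simps)
  also have "\<dots> = (\<integral>\<^sup>+ s. (\<Sum>i<N. ennreal (D i) * indicator (J i) s) \<partial>lborel)"
    by (subst nn_integral_sum) (auto simp: J_def nn_integral_cmult_indicator)
  also have "\<dots> \<le> (\<integral>\<^sup>+ s \<in> {0..L}. g (\<sigma> s) \<partial>lborel)"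
    by (intro nn_integral_mono pointwise)
  finally show ?thesis .
qed

section \<open>Doubling measures and averages\<close>

text \<open>The balls are the sections of the open set of pairs at distance less than
  \<open>r\<close>; by second countability this set lies in the product sigma-algebra, and section
  measures are measurable.\<close>

lemma borel_measurable_emeasure_ball:
  fixes \<mu> :: "'a::{metric_space, second_countable_topology} measure"
  assumes "sigma_finite_measure \<mu>" "sets \<mu> = sets borel"
  shows "(\<lambda>w. emeasure \<mu> (ball w r)) \<in> borel_measurable borel"
proof -
  interpret sigma_finite_measure \<mu> by fact
  have "open {(w, z). dist (w::'a) z < r}"
    unfolding case_prod_unfold by (intro open_Collect_less continuous_intros)
  then have "{(w, z). dist (w::'a) z < r} \<in> sets (borel \<Otimes>\<^sub>M \<mu>)"
    unfolding sets_pair_measure_cong[OF refl assms(2)] borel_prod by (rule borel_open)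
  from measurable_emeasure_Pair[OF this]
  show ?thesis by (simp add: ball_def vimage_def)
qed

lemma volume_doubling_ball:
  assumes "volume_doubling m" "r > 0"
  shows "0 < emeasure m (ball x r)" "emeasure m (ball x r) < \<infinity>"
proof -
  obtain C where C: "C > 1" and vd: "\<And>x r. r > 0 \<Longrightarrow> 0 < emeasure m (ball x (2 * r)) \<and>
      ennreal C * emeasure m (ball x r) < \<infinity>"
    using assms(1) unfolding volume_doubling_def by blast
  show "0 < emeasure m (ball x r)" using vd[of "r / 2" x] assms(2) by simp
  show "emeasure m (ball x r) < \<infinity>"
    using vd[of r x] assms(2) C by (auto simp: ennreal_mult_less_top)
qed

text \<open>Doubling is iterated \<open>k\<close> times, where 2^k exceeds \<open>c\<close>; neither
  \<open>k\<close> nor the constant depends on the ball.\<close>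

lemma volume_doubling_scale:
  assumes "volume_doubling m" "sets m = sets borel"
  shows "\<exists>D\<ge>0. \<forall>x. \<forall>r>0. emeasure m (ball x (c * r)) \<le> ennreal D * emeasure m (ball x r)"
proof -
  obtain C where C: "C > 1" and vd: "\<And>x r. r > 0 \<Longrightarrow>
      emeasure m (ball x (2 * r)) \<le> ennreal C * emeasure m (ball x r)"
    using assms(1) unfolding volume_doubling_def by blast
  have pow: "emeasure m (ball x (2 ^ k * r)) \<le> ennreal (C ^ k) * emeasure m (ball x r)" if "r > 0" for k x r
  proof (induction k)
    case (Suc k)
    have "emeasure m (ball x (2 ^ Suc k * r)) \<le> ennreal C * emeasure m (ball x (2 ^ k * r))"
      using vd[of "2 ^ k * r" x] that by (simp add: mult.assoc)
    also have "\<dots> \<le> ennreal C * (ennreal (C ^ k) * emeasure m (ball x r))"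
      by (intro mult_left_mono Suc) simp
    also have "\<dots> = ennreal (C ^ Suc k) * emeasure m (ball x r)"
      using C by (simp add: ennreal_mult mult.assoc)
    finally show ?case .
  qed simp
  obtain k where k: "c < 2 ^ k"
    using real_arch_pow[of 2 c] by auto
  show ?thesis
  proof (intro exI[of _ "C ^ k"] conjI allI impI)
    fix x and r :: real assume "r > 0"
    have "emeasure m (ball x (c * r)) \<le> emeasure m (ball x (2 ^ k * r))"
      using k \<open>r > 0\<close> assms(2) by (intro emeasure_mono subset_ball) auto
    also note pow[OF \<open>r > 0\<close>]
    finally show "emeasure m (ball x (c * r)) \<le> ennreal (C ^ k) * emeasure m (ball x r)" .
  qed (use C in simp)
qed

text \<open>Serves to replace the reciprocal measure of a ball around \<open>w\<close> by that of a
  ball around a nearby \<open>z\<close>.\<close>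

lemma ennreal_inverse_le_divide:
  fixes a b :: ennreal
  assumes "0 < a" "a < \<infinity>" "0 < b" "b < \<infinity>" "b \<le> ennreal D * a" "0 \<le> D"
  shows "1 / a \<le> ennreal D / b"
proof -
  obtain a' b' where ab: "a = ennreal a'" "b = ennreal b'" "0 \<le> a'" "0 \<le> b'"
    using assms(2,4) by (cases a; cases b) auto
  with assms show ?thesis
    by (simp add: ennreal_mult[symmetric] divide_ennreal ennreal_1[symmetric] field_simps del: ennreal_1)
qed

text \<open>Write the numerator as a \<mu>-integral over \<open>z\<close> and apply Fubini. For
  fixed \<open>z\<close> the integrand lives on \<open>ball z s\<close>, where by
  \<open>ratio\<close> it is at most \<open>D\<close> divided by the measure of that same ball, so
  the inner integral is at most \<open>D\<close>.\<close>

lemma nn_integral_ball_ratio_le: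
  fixes \<mu> m :: "'a::{metric_space, second_countable_topology} measure"
  assumes "sigma_finite_measure \<mu>" "sets \<mu> = sets borel" "sigma_finite_measure m" "sets m = sets borel"
    and ratio: "\<And>w z. dist w z < s \<Longrightarrow> emeasure m (ball z s) \<le> ennreal D * emeasure m (ball w t)"
    and "0 \<le> D"
    and pos: "\<And>w. 0 < emeasure m (ball w s)" "\<And>w. 0 < emeasure m (ball w t)"
    and fin: "\<And>w. emeasure m (ball w s) < \<infinity>" "\<And>w. emeasure m (ball w t) < \<infinity>"
  shows "(\<integral>\<^sup>+ w. emeasure \<mu> (ball w s) / emeasure m (ball w t) \<partial>m) \<le> ennreal D * emeasure \<mu> UNIV"
proof -
  interpret \<mu>: sigma_finite_measure \<mu> by fact
  interpret m: sigma_finite_measure m by fact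
  interpret pair_sigma_finite \<mu> m ..
  note [measurable_cong] = assms(2,4)
  have [measurable]: "(\<lambda>w. emeasure m (ball w t)) \<in> borel_measurable borel"
    using assms(3,4) by (rule borel_measurable_emeasure_ball)
  have "open {(z, w). dist (w::'a) z < s}"
    unfolding case_prod_unfold by (intro open_Collect_less continuous_intros)
  then have [measurable]: "{(z, w). dist (w::'a) z < s} \<in> sets (borel \<Otimes>\<^sub>M borel)"
    unfolding borel_prod by (rule borel_open)
  have meas: "(\<lambda>(z, w). indicator {(z, w). dist w z < s} (z, w) / emeasure m (ball w t) :: ennreal)
      \<in> borel_measurable (\<mu> \<Otimes>\<^sub>M m)"
    by measurable
  have "(\<integral>\<^sup>+ w. emeasure \<mu> (ball w s) / emeasure m (ball w t) \<partial>m)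
      = (\<integral>\<^sup>+ w. (\<integral>\<^sup>+ z. indicator (ball w s) z / emeasure m (ball w t) \<partial>\<mu>) \<partial>m)"
  proof (intro nn_integral_cong)
    fix w
    have "(indicator (ball w s) :: 'a \<Rightarrow> ennreal) \<in> borel_measurable \<mu>"
      by (rule borel_measurable_indicator) (simp add: assms(2))
    then show "emeasure \<mu> (ball w s) / emeasure m (ball w t) = (\<integral>\<^sup>+ z. indicator (ball w s) z / emeasure m (ball w t) \<partial>\<mu>)"
      by (simp add: nn_integral_divide assms(2))
  qed
  also have "\<dots> = (\<integral>\<^sup>+ w. (\<integral>\<^sup>+ z. indicator {(z, w). dist w z < s} (z, w) / emeasure m (ball w t) \<partial>\<mu>) \<partial>m)"
    by (intro nn_integral_cong) (simp add: indicator_def)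
  also have "\<dots> = (\<integral>\<^sup>+ z. (\<integral>\<^sup>+ w. indicator {(z, w). dist w z < s} (z, w) / emeasure m (ball w t) \<partial>m) \<partial>\<mu>)"
    by (rule Fubini'[OF meas])
  also have "\<dots> \<le> (\<integral>\<^sup>+ z. ennreal D \<partial>\<mu>)"
  proof (rule nn_integral_mono)
    fix z
    have "indicator {(z, w). dist w z < s} (z, w) / emeasure m (ball w t) \<le>
        (ennreal D / emeasure m (ball z s)) * indicator (ball z s) w" for w
      using ennreal_inverse_le_divide[OF pos(2)[of w] fin(2)[of w] pos(1)[of z] fin(1)[of z] ratio \<open>0 \<le> D\<close>]
      by (auto simp: indicator_def dist_commute[of z w])
    then have "(\<integral>\<^sup>+ w. indicator {(z, w). dist w z < s} (z, w) / emeasure m (ball w t) \<partial>m)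
       \<le> (\<integral>\<^sup>+ w. (ennreal D / emeasure m (ball z s)) * indicator (ball z s) w \<partial>m)"
      by (rule nn_integral_mono)
    also have "\<dots> = ennreal D / emeasure m (ball z s) * emeasure m (ball z s)"
      using assms(4) by (simp add: nn_integral_cmult_indicator)
    also have "\<dots> \<le> ennreal D"
      using pos(1)[of z] fin(1)[of z] by (simp add: ennreal_divide_times ennreal_times_divide[symmetric] ennreal_divide_self less_top)
    finally show "(\<integral>\<^sup>+ w. indicator {(z, w). dist w z < s} (z, w) / emeasure m (ball w t) \<partial>m) \<le> ennreal D" .
  qed
  also have "\<dots> = ennreal D * emeasure \<mu> UNIV"
    using assms(2) sets_eq_imp_space_eq[OF assms(2)] by simp
  finally show ?thesis .
qed

lemma ball_subset_ballI:
  assumes "dist y w + r \<le> s"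
  shows "ball y r \<subseteq> ball w s"
proof
  fix x assume "x \<in> ball y r"
  with assms dist_triangle[of w x y] show "x \<in> ball w s"
    by (simp add: dist_commute)
qed

lemma volume_doubling_sigma_finite:
  assumes "volume_doubling m" "sets m = sets borel"
  shows "sigma_finite_measure m"
proof
  fix x :: 'a
  let ?A = "range (\<lambda>n. ball x (real (Suc n)))"
  have "\<Union>?A = UNIV"
  proof (intro set_eqI iffI UNIV_I)
    fix y
    obtain n where "dist x y < real n" using reals_Archimedean2 by blast
    then show "y \<in> \<Union>?A" by (auto intro!: exI[of _ n])
  qed
  then show "\<exists>A. countable A \<and> A \<subseteq> sets m \<and> \<Union>A = space m \<and> (\<forall>a\<in>A. emeasure m a \<noteq> \<infinity>)"
    using volume_doubling_ball(2)[OF assms(1), of "real (Suc _)" x] assms(2)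
    by (intro exI[of _ ?A]) (auto simp: sets_eq_imp_space_eq[OF assms(2)] less_top)
qed

section \<open>Averages over balls\<close>

text \<open>The radius \<open>d\<close> may depend on \<open>x\<close>: only the two end points of a
  piece of a curve are going to be compared with their averages.\<close>

lemma average_near_value:
  fixes m :: "'a::metric_space measure"
  assumes vd: "volume_doubling m" and sets: "sets m = sets borel"
    and f: "continuous_on UNIV f" and "e > 0"
  shows "\<exists>d>0. \<forall>r. 0 < r \<and> r < d \<longrightarrow> \<bar>average m (ball x r) f - f x\<bar> \<le> e"
proof -
  have "\<exists>d>0. \<forall>y. dist y x < d \<longrightarrow> dist (f y) (f x) < e"
    using f \<open>e > 0\<close> unfolding continuous_on_iff by simp
  then obtain d where d: "d > 0" "\<And>y. dist y x < d \<Longrightarrow> dist (f y) (f x) < e"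
    by blast
  have "\<bar>average m (ball x r) f - f x\<bar> \<le> e" if r: "0 < r" "r < d" for r
  proof -
    let ?B = "ball x r"
    have fin: "emeasure m ?B < \<infinity>" and pos: "0 < emeasure m ?B"
      using volume_doubling_ball[OF vd r(1)] by blast+
    then have mpos: "0 < measure m ?B"
      by (simp add: measure_def enn2real_positive_iff)
    have B: "?B \<in> sets m" using sets by simp
    have near: "\<bar>f y - f x\<bar> \<le> e" if "y \<in> ?B" for y
      using d(2)[of y] that r by (auto simp: dist_real_def dist_commute)
    have meas: "f \<in> borel_measurable m"
      using f by (simp add: borel_measurable_continuous_onI measurable_cong_sets[OF sets refl])
    have int: "set_integrable m ?B f"
      unfolding set_integrable_def
    proof (rule integrableI_bounded_set_indicator[OF B meas fin])
      show "AE y in m. y \<in> ?B \<longrightarrow> norm (f y) \<le> \<bar>f x\<bar> + e"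
        using near by (intro AE_I2) force
    qed
    have int_const: "set_integrable m ?B (\<lambda>_. c :: real)" for c
      unfolding set_integrable_def using fin B by simp
    have val_const: "(LINT y:?B|m. c) = c * measure m ?B" for c :: real
      unfolding set_lebesgue_integral_def using B by simp
    have "(LINT y:?B|m. f y) \<le> (LINT y:?B|m. f x + e)"
      using near by (intro set_integral_mono int int_const) (force simp: abs_le_iff)
    moreover have "(LINT y:?B|m. f x - e) \<le> (LINT y:?B|m. f y)"
      using near by (intro set_integral_mono int int_const) (force simp: abs_le_iff)
    ultimately have "f x - e \<le> average m ?B f" "average m ?B f \<le> f x + e"
      using mpos unfolding val_const average_def by (simp_all add: field_simps)
    then show ?thesis by (simp add: abs_le_iff)
  qed
  with d(1) show ?thesis by blast
qed

text \<open>The triangle inequality through \<open>x\<close> bounds the left base by twice a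
  maximum, which yields the crude constant 2^p.\<close>

lemma abs_diff_powr_le:
  fixes a b x :: real
  assumes "p > 0"
  shows "\<bar>a - b\<bar> powr p \<le> 2 powr p * (\<bar>x - a\<bar> powr p + \<bar>x - b\<bar> powr p)"
proof -
  have "\<bar>a - b\<bar> \<le> 2 * max \<bar>x - a\<bar> \<bar>x - b\<bar>"
    by (simp add: max_def abs_if)
  then have "\<bar>a - b\<bar> powr p \<le> (2 * max \<bar>x - a\<bar> \<bar>x - b\<bar>) powr p"
    using assms by (intro powr_mono2) auto
  also have "\<dots> = 2 powr p * max \<bar>x - a\<bar> \<bar>x - b\<bar> powr p"
    by (simp add: powr_mult)
  also have "\<dots> \<le> 2 powr p * (\<bar>x - a\<bar> powr p + \<bar>x - b\<bar> powr p)"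
    by (intro mult_left_mono) (auto simp: max_def)
  finally show ?thesis .
qed

text \<open>Integrate the preceding inequality, with \<open>u y\<close> as intermediate value, over
  the common part \<open>B\<close> and then enlarge \<open>B\<close> to \<open>S\<close> and
  \<open>S'\<close>. It is meant for two balls \<open>S\<close>, \<open>S'\<close> and the averages
  \<open>c\<close>, \<open>c'\<close> of \<open>u\<close> on them.\<close>

lemma abs_diff_powr_times_emeasure_le:
  fixes u :: "'a \<Rightarrow> real"
  assumes "p > 0" and [measurable]: "u \<in> borel_measurable m" "B \<in> sets m" "S \<in> sets m" "S' \<in> sets m"
    and sub: "B \<subseteq> S" "B \<subseteq> S'"
  shows "ennreal (\<bar>c - c'\<bar> powr p) * emeasure m B \<le>
    ennreal (2 powr p) * ((\<integral>\<^sup>+ y \<in> S. ennreal (\<bar>u y - c\<bar> powr p) \<partial>m) +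
      (\<integral>\<^sup>+ y \<in> S'. ennreal (\<bar>u y - c'\<bar> powr p) \<partial>m))"
proof -
  have "ennreal (\<bar>c - c'\<bar> powr p) * emeasure m B = (\<integral>\<^sup>+ y. ennreal (\<bar>c - c'\<bar> powr p) * indicator B y \<partial>m)"
    by (simp add: nn_integral_cmult_indicator)
  also have "\<dots> \<le> (\<integral>\<^sup>+ y. ennreal (2 powr p) * (ennreal (\<bar>u y - c\<bar> powr p) * indicator S y +
      ennreal (\<bar>u y - c'\<bar> powr p) * indicator S' y) \<partial>m)"
  proof (rule nn_integral_mono)
    fix y
    show "ennreal (\<bar>c - c'\<bar> powr p) * indicator B y \<le>
      ennreal (2 powr p) * (ennreal (\<bar>u y - c\<bar> powr p) * indicator S y +
      ennreal (\<bar>u y - c'\<bar> powr p) * indicator S' y)"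
    proof (cases "y \<in> B")
      case True
      then have "y \<in> S" "y \<in> S'" using sub by auto
      then show ?thesis
        using True abs_diff_powr_le[OF assms(1), of c c' "u y"]
        by (simp add: ennreal_plus[symmetric] ennreal_mult[symmetric] ennreal_leI del: ennreal_plus)
    qed simp
  qed
  also have "\<dots> = ennreal (2 powr p) * ((\<integral>\<^sup>+ y \<in> S. ennreal (\<bar>u y - c\<bar> powr p) \<partial>m) +
      (\<integral>\<^sup>+ y \<in> S'. ennreal (\<bar>u y - c'\<bar> powr p) \<partial>m))"
    by (subst nn_integral_cmult) (auto simp: nn_integral_add)
  finally show ?thesis .
qed

section \<open>Oscillation of averages and the modulus of curves\<close>

text \<open>A vanishing lower limit gives small values along some radii only, so the radius has to
  be picked rather than prescribed.\<close>

lemma Liminf_at_right_zero_frequently: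
  fixes f :: "real \<Rightarrow> real"
  assumes "Liminf (at_right 0) (\<lambda>r. ereal (f r)) = 0" "\<eta> > 0" "\<delta> > 0"
  shows "\<exists>r. 0 < r \<and> r < \<delta> \<and> f r < \<eta>"
proof (rule ccontr)
  assume contra: "\<not> ?thesis"
  have "\<forall>\<^sub>F r in at_right 0. r \<in> {0<..<\<delta>}"
    by (rule eventually_at_right_real[OF \<open>\<delta> > 0\<close>])
  then have "\<forall>\<^sub>F r in at_right 0. ereal \<eta> \<le> ereal (f r)"
    by eventually_elim (use contra in \<open>force simp: not_less\<close>)
  then have "ereal \<eta> \<le> Liminf (at_right 0) (\<lambda>r. ereal (f r))"
    by (rule Liminf_bounded)
  with assms show False by simp
qed

text \<open>\<open>N\<close>, \<open>\<delta>\<close> and \<open>\<eta>\<close> are given first and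
  \<open>R\<close> is chosen last, since \<Psi>(R)/R^p is small along some radii only. The factor
  R/4 is half of R/2, as the chaining estimate requires at scale R/2.\<close>

lemma (in regular_local_dirichlet_space) oscillation_density:
  assumes "1 < p" and \<Psi>: "scale_function \<Psi>" and vd: "volume_doubling m"
    and PI: "poincare_inequality p \<Psi> m \<F> \<Gamma>"
    and small: "Liminf (at_right 0) (\<lambda>r. ereal (\<Psi> r / r powr p)) = 0"
    and u: "u \<in> \<F>" and "N > 0" "\<delta> > 0" "\<eta> > 0"
  shows "\<exists>R H. 0 < R \<and> R < \<delta> \<and> H \<in> borel_measurable borel \<and> (\<integral>\<^sup>+ x. H x \<partial>m) \<le> ennreal \<eta> \<and>
    (\<forall>z z' w. dist z w \<le> R / 2 \<longrightarrow> dist z' w \<le> R / 2 \<longrightarrow>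
      ennreal \<bar>N * average m (ball z R) u - N * average m (ball z' R) u\<bar>
        \<le> ennreal (R / 4) * enn_powr (H w) (1 / p))"
proof -
  have sets_m: "sets m = sets borel" using radon by (simp add: radon_measure_def)
  note [measurable_cong] = sets_m
  note sf = volume_doubling_sigma_finite[OF vd sets_m]
  have sets_\<Gamma>: "sets (\<Gamma> u) = sets borel" using u by (rule sets_energy)
  interpret \<Gamma>: finite_measure "\<Gamma> u" using u by (rule finite_energy)
  have u_meas [measurable]: "u \<in> borel_measurable m"
    using u subset_lp by (auto simp: real_lp_fun_def)
  obtain C A where C: "C > 0" and A: "A \<ge> 1"
    and PI': "\<And>x r. r > 0 \<Longrightarrow>
       (\<integral>\<^sup>+ y \<in> ball x r. ennreal (\<bar>u y - average m (ball x r) u\<bar> powr p) \<partial>m)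
         \<le> ennreal (C * \<Psi> r) * emeasure (\<Gamma> u) (ball x (A * r))"
    using PI u unfolding poincare_inequality_def by blast
  \<comment> \<open>The factor \<open>8 * A\<close> turns the radius R/2 into 4AR, enough for the
    ball around \<open>w\<close> to contain \<open>ball z (2 * A * R)\<close> whenever
    \<open>z\<close> is within 2AR of \<open>w\<close>.\<close>
  obtain D where D: "D \<ge> 0" and D': "\<And>x r. r > 0 \<Longrightarrow>
      emeasure m (ball x (8 * A * r)) \<le> ennreal D * emeasure m (ball x r)"
    using volume_doubling_scale[OF vd sets_m, of "8 * A"] by blast
  \<comment> \<open>All constants of the final estimate: (4N)^p from rescaling the oscillation, 2^p
    from splitting the difference, 2 from the two balls, \<open>C\<close> from the Poincare
    inequality.\<close>
  define K where "K = (4 * N) powr p * (2 * 2 powr p * C)"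
  define E where "E = measure (\<Gamma> u) UNIV"
  have K: "K > 0" using \<open>N > 0\<close> C by (simp add: K_def)
  have E: "E \<ge> 0" "emeasure (\<Gamma> u) UNIV = ennreal E"
    by (auto simp: E_def \<Gamma>.emeasure_eq_measure)
  \<comment> \<open>The summand 1 keeps the denominator positive when the energy or \<open>D\<close>
    vanishes.\<close>
  define \<eta>' where "\<eta>' = \<eta> / (K * D * E + 1)"
  have den: "K * D * E + 1 > 0" using K D E(1) by (simp add: add_nonneg_pos)
  have "\<eta>' > 0" using \<open>\<eta> > 0\<close> den by (simp add: \<eta>'_def)
  from Liminf_at_right_zero_frequently[OF small this \<open>\<delta> > 0\<close>]
  obtain R where R: "0 < R" "R < \<delta>" "\<Psi> R / R powr p < \<eta>'" by blast
  have \<Psi>R: "\<Psi> R > 0"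
    using \<Psi> R(1) unfolding scale_function_def bij_betw_def by auto
  \<comment> \<open>Chosen to dominate the p-th power of 4N/R times the difference of any two
    averages with centres within R/2 of \<open>w\<close>.\<close>
  define H where "H w = ennreal (K * (\<Psi> R / R powr p)) *
      (emeasure (\<Gamma> u) (ball w (2 * A * R)) / emeasure m (ball w (R / 2)))" for w
  have [measurable]: "(\<lambda>w. emeasure m (ball w r)) \<in> borel_measurable borel"
    "(\<lambda>w. emeasure (\<Gamma> u) (ball w r)) \<in> borel_measurable borel" for r
    by (intro borel_measurable_emeasure_ball sf sets_m sets_\<Gamma> \<Gamma>.sigma_finite_measure_axioms)+
  have H_meas: "H \<in> borel_measurable borel"
    unfolding H_def by measurable
  have "(\<integral>\<^sup>+ x. H x \<partial>m) = ennreal (K * (\<Psi> R / R powr p)) *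
      (\<integral>\<^sup>+ w. emeasure (\<Gamma> u) (ball w (2 * A * R)) / emeasure m (ball w (R / 2)) \<partial>m)"
    unfolding H_def by (rule nn_integral_cmult) measurable
  also have "\<dots> \<le> ennreal (K * (\<Psi> R / R powr p)) * (ennreal D * emeasure (\<Gamma> u) UNIV)"
  proof (intro mult_left_mono nn_integral_ball_ratio_le)
    fix w z :: 'a assume "dist w z < 2 * A * R"
    then have "ball z (2 * A * R) \<subseteq> ball w (8 * A * (R / 2))"
      by (intro ball_subset_ballI) (simp add: dist_commute)
    then have "emeasure m (ball z (2 * A * R)) \<le> emeasure m (ball w (8 * A * (R / 2)))"
      by (rule emeasure_mono) (simp add: sets_m)
    also have "\<dots> \<le> ennreal D * emeasure m (ball w (R / 2))"
      using R(1) by (intro D') simp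
    finally show "emeasure m (ball z (2 * A * R)) \<le> ennreal D * emeasure m (ball w (R / 2))" .
  qed (use R(1) A D sf sets_m sets_\<Gamma> \<Gamma>.sigma_finite_measure_axioms in
      \<open>simp_all add: volume_doubling_ball[OF vd] volume_doubling_ball(2)[OF vd, simplified]\<close>)
  also have "\<dots> = ennreal (K * D * E * (\<Psi> R / R powr p))"
    unfolding E(2) using K D E(1) \<Psi>R by (simp add: ennreal_mult[symmetric] ac_simps)
  also have "\<dots> \<le> ennreal \<eta>"
  proof (rule ennreal_leI)
    have "K * D * E * (\<Psi> R / R powr p) \<le> (K * D * E + 1) * \<eta>'"
      using R(3) K D E(1) \<Psi>R by (intro mult_mono) auto
    also have "\<dots> = \<eta>" using den by (simp add: \<eta>'_def)
    finally show "K * D * E * (\<Psi> R / R powr p) \<le> \<eta>" .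
  qed
  finally have H_int: "(\<integral>\<^sup>+ x. H x \<partial>m) \<le> ennreal \<eta>" .
  have step: "ennreal \<bar>N * average m (ball z R) u - N * average m (ball z' R) u\<bar>
        \<le> ennreal (R / 4) * enn_powr (H w) (1 / p)"
    if zw: "dist z w \<le> R / 2" and zw': "dist z' w \<le> R / 2" for z z' w
  proof -
    define a where "a = \<bar>average m (ball z R) u - average m (ball z' R) u\<bar>"
    define \<mu> where "\<mu> = emeasure m (ball w (R / 2))"
    define g where "g = emeasure (\<Gamma> u) (ball w (2 * A * R))"
    have \<mu>: "0 < \<mu>" "\<mu> < \<infinity>"
      using volume_doubling_ball[OF vd, of "R / 2" w] R(1) by (auto simp: \<mu>_def)
    \<comment> \<open>The inclusions rest on R/2 + R/2 = R and, since \<open>A\<close> is at least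
      1, on AR + R/2 being at most 2AR.\<close>
    have sub: "ball w (R / 2) \<subseteq> ball y R" "ball y (A * R) \<subseteq> ball w (2 * A * R)" if "dist y w \<le> R / 2" for y
    proof -
      have "R \<le> A * R" using A R(1) by simp
      moreover have "0 < R" by (rule R(1))
      ultimately show "ball w (R / 2) \<subseteq> ball y R" "ball y (A * R) \<subseteq> ball w (2 * A * R)"
        using that by (intro ball_subset_ballI; simp add: dist_commute; linarith)+
    qed
    have osc: "(\<integral>\<^sup>+ x \<in> ball y R. ennreal (\<bar>u x - average m (ball y R) u\<bar> powr p) \<partial>m) \<le> ennreal (C * \<Psi> R) * g"
      if "dist y w \<le> R / 2" for y
    proof -
      have "emeasure (\<Gamma> u) (ball y (A * R)) \<le> g"
        unfolding g_def by (rule emeasure_mono[OF sub(2)[OF that]]) (simp add: sets_\<Gamma>)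
      then have "ennreal (C * \<Psi> R) * emeasure (\<Gamma> u) (ball y (A * R)) \<le> ennreal (C * \<Psi> R) * g"
        by (rule mult_left_mono) simp
      with PI'[OF R(1), of y] show ?thesis by (rule order_trans)
    qed
    have "ennreal (a powr p) * \<mu> \<le> ennreal (2 powr p) * (ennreal (C * \<Psi> R) * g + ennreal (C * \<Psi> R) * g)"
    proof -
      have "ennreal (a powr p) * \<mu> \<le> ennreal (2 powr p) *
          ((\<integral>\<^sup>+ x \<in> ball z R. ennreal (\<bar>u x - average m (ball z R) u\<bar> powr p) \<partial>m) +
           (\<integral>\<^sup>+ x \<in> ball z' R. ennreal (\<bar>u x - average m (ball z' R) u\<bar> powr p) \<partial>m))"
        unfolding a_def \<mu>_def using assms(1) sets_m
        by (intro abs_diff_powr_times_emeasure_le sub(1) zw zw' u_meas) auto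
      also have "\<dots> \<le> ennreal (2 powr p) * (ennreal (C * \<Psi> R) * g + ennreal (C * \<Psi> R) * g)"
        by (intro mult_left_mono add_mono osc zw zw') auto
      finally show ?thesis .
    qed
    also have "\<dots> = ennreal (2 * 2 powr p * C * \<Psi> R) * g"
    proof -
      have "ennreal (C * \<Psi> R) * g + ennreal (C * \<Psi> R) * g = ennreal (2 * (C * \<Psi> R)) * g"
        unfolding distrib_right[symmetric] using C \<Psi>R by (subst ennreal_plus[symmetric]) auto
      then show ?thesis
        using C \<Psi>R by (simp add: mult.assoc[symmetric] ennreal_mult[symmetric]) (simp add: ac_simps)
    qed
    finally have "ennreal (a powr p) * \<mu> / \<mu> \<le> ennreal (2 * 2 powr p * C * \<Psi> R) * g / \<mu>"
      by (rule divide_right_mono_ennreal)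
    then have "ennreal (a powr p) \<le> ennreal (2 * 2 powr p * C * \<Psi> R) * g / \<mu>"
      using \<mu> by (simp add: mult_divide_eq_ennreal)
    \<comment> \<open>Scaling by (4N/R)^p turns the right side into \<open>H w\<close>; taking the
      p-th root and multiplying by R/4 then isolates N times the difference.\<close>
    then have "ennreal ((4 * N / R) powr p) * ennreal (a powr p) \<le>
        ennreal ((4 * N / R) powr p) * (ennreal (2 * 2 powr p * C * \<Psi> R) * g / \<mu>)"
      by (intro mult_left_mono) auto
    also have "\<dots> = H w"
    proof -
      have "(4 * N / R) powr p * (2 * 2 powr p * C * \<Psi> R) = K * (\<Psi> R / R powr p)"
        using \<open>N > 0\<close> R(1) by (simp add: K_def powr_divide)
      then show ?thesis
        using \<open>N > 0\<close> R(1) C \<Psi>R unfolding H_def g_def[symmetric] \<mu>_def[symmetric]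
        by (simp add: ennreal_times_divide mult.assoc[symmetric] ennreal_mult[symmetric])
    qed
    also have "ennreal ((4 * N / R) powr p) * ennreal (a powr p) = ennreal ((4 * N / R * a) powr p)"
      using \<open>N > 0\<close> R(1) by (subst powr_mult) (auto simp: a_def ennreal_mult)
    also have "\<dots> = enn_powr (ennreal (4 * N / R * a)) p"
      using \<open>N > 0\<close> R(1) by (subst enn_powr_ennreal) (auto simp: a_def)
    finally have "enn_powr (enn_powr (ennreal (4 * N / R * a)) p) (1 / p) \<le> enn_powr (H w) (1 / p)"
      using assms(1) by (intro enn_powr_mono) auto
    then have "ennreal (4 * N / R * a) \<le> enn_powr (H w) (1 / p)"
      using assms(1) by (simp add: enn_powr_inverse)
    then have "ennreal (R / 4) * ennreal (4 * N / R * a) \<le> ennreal (R / 4) * enn_powr (H w) (1 / p)"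
      by (intro mult_left_mono) auto
    also have "ennreal (R / 4) * ennreal (4 * N / R * a) = ennreal (N * a)"
      using R(1) by (simp add: ennreal_mult'[symmetric])
    also have "N * a = \<bar>N * average m (ball z R) u - N * average m (ball z' R) u\<bar>"
      using \<open>N > 0\<close> by (simp add: a_def abs_mult right_diff_distrib[symmetric])
    finally show ?thesis .
  qed
  show ?thesis
    using R(1,2) H_meas H_int step by blast
qed

section \<open>Functions of finite energy that separate points\<close>

text \<open>The real supremum in \<open>dense_sup\<close> controls the individual values once the
  differences are known to be bounded, which follows from this.\<close>

lemma Cc_bounded_range:
  assumes "f \<in> C\<^sub>c"
  shows "bounded (range f)"
proof -
  let ?K = "closure {x. f x \<noteq> 0}"
  have "compact (f ` ?K)"
    using assms unfolding compactly_supported_continuous_def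
    by (auto intro: compact_continuous_image continuous_on_subset)
  then have "bounded (insert 0 (f ` ?K))"
    by (simp add: compact_imp_bounded)
  moreover have "range f \<subseteq> insert 0 (f ` ?K)"
    using closure_subset[of "{x. f x \<noteq> 0}"] by auto
  ultimately show ?thesis by (rule bounded_subset)
qed

text \<open>A cone with peak height \<open>s\<close> at \<open>x\<close> that vanishes at
  \<open>y\<close> is approximated uniformly up to s/3, which keeps the two values apart.\<close>

lemma (in regular_local_dirichlet_space) exists_separating_function:
  assumes "x \<noteq> y"
  shows "\<exists>f \<in> C\<^sub>c \<inter> \<F>. f x \<noteq> f y"
proof -
  have "\<exists>U V. x \<in> U \<and> U \<subseteq> V \<and> V \<subseteq> UNIV \<and> openin (top_of_set UNIV) U \<and> compact V"
    using locally_compact unfolding Homotopy.locally_compact by (rule bspec) simp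
  then obtain U V where UV: "x \<in> U" "U \<subseteq> V" "open U" "compact V"
    by (metis open_openin subtopology_UNIV)
  obtain e where e: "e > 0" "cball x e \<subseteq> U"
    using UV(1,3) open_contains_cball by blast
  \<comment> \<open>At most \<open>e\<close>, so that the support of the cone lies in the compact
    set \<open>V\<close>; at most the distance of the two points, so that the cone vanishes at
    \<open>y\<close>.\<close>
  define s where "s = min e (dist x y)"
  have s: "s > 0" "s \<le> e" "s \<le> dist x y" using e assms by (auto simp: s_def)
  define \<phi> where "\<phi> z = max 0 (s - dist x z)" for z
  have cont: "continuous_on UNIV \<phi>"
    unfolding \<phi>_def by (intro continuous_intros)
  have "closure {z. \<phi> z \<noteq> 0} \<subseteq> cball x s"
    by (rule closure_minimal) (auto simp: \<phi>_def max_def split: if_splits)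
  also have "\<dots> \<subseteq> V" using e(2) s(2) UV(2) by (auto simp: subset_iff)
  finally have "compact (V \<inter> closure {z. \<phi> z \<noteq> 0})" "V \<inter> closure {z. \<phi> z \<noteq> 0} = closure {z. \<phi> z \<noteq> 0}"
    using UV(4) by (auto intro: compact_Int_closed)
  then have \<phi>: "\<phi> \<in> C\<^sub>c"
    using cont by (simp add: compactly_supported_continuous_def)
  obtain g where g: "g \<in> C\<^sub>c \<inter> \<F>" "(SUP z. \<bar>\<phi> z - g z\<bar>) < s / 3"
    using dense_sup[OF \<phi>, of "s / 3"] s(1) by auto
  have bdd: "bdd_above (range (\<lambda>z. \<bar>\<phi> z - g z\<bar>))"
  proof -
    obtain B B' where "\<And>z. \<bar>\<phi> z\<bar> \<le> B" "\<And>z. \<bar>g z\<bar> \<le> B'"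
      using Cc_bounded_range[OF \<phi>] Cc_bounded_range[of g] g(1) unfolding bounded_iff by auto
    then have "\<bar>\<phi> z - g z\<bar> \<le> B + B'" for z
      by (intro order_trans[OF abs_triangle_ineq4] add_mono)
    then show ?thesis by (intro bdd_aboveI[of _ "B + B'"]) auto
  qed
  have close: "\<bar>\<phi> z - g z\<bar> < s / 3" for z
    using cSUP_upper[OF UNIV_I bdd, of z] g(2) by simp
  have "\<phi> x = s" "\<phi> y = 0" using s by (auto simp: \<phi>_def)
  then have "g x \<noteq> g y" using close[of x] close[of y] s(1) by auto
  with g(1) show ?thesis by blast
qed

text \<open>Each continuous function separates an open set of pairs, and these sets cover the
  complement of the diagonal. Lindelof's theorem in the product space leaves countably many of
  them.\<close>

lemma (in regular_local_dirichlet_space) countable_separating_family: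
  "\<exists>u :: nat \<Rightarrow> 'a \<Rightarrow> real. (\<forall>k. u k \<in> C\<^sub>c \<inter> \<F>) \<and> (\<forall>x y. x \<noteq> y \<longrightarrow> (\<exists>k. u k x \<noteq> u k y))"
proof -
  let ?S = "\<lambda>f :: 'a \<Rightarrow> real. {z. f (fst z) \<noteq> f (snd z)}"
  have "open (?S f)" if "f \<in> C\<^sub>c \<inter> \<F>" for f
  proof -
    have "continuous_on UNIV f"
      using that by (simp add: compactly_supported_continuous_def)
    then have "continuous_on UNIV (\<lambda>z. f (fst z))" "continuous_on UNIV (\<lambda>z. f (snd z))"
      by (rule continuous_on_compose2; auto intro: continuous_intros)+
    then show ?thesis by (rule open_Collect_neq)
  qed
  then have op: "open Z" if "Z \<in> ?S ` (C\<^sub>c \<inter> \<F>)" for Z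
    using that by (elim imageE) simp
  obtain T where T: "T \<subseteq> ?S ` (C\<^sub>c \<inter> \<F>)" "countable T" "\<Union>T = \<Union>(?S ` (C\<^sub>c \<inter> \<F>))"
    by (rule Lindelof[OF op]) (assumption, rule that)
  \<comment> \<open>Returns from the countably many open sets to countably many functions producing
    them.\<close>
  have "\<exists>G. countable G \<and> G \<subseteq> C\<^sub>c \<inter> \<F> \<and> T = ?S ` G"
    using T(1,2) by (simp only: countable_subset_image[symmetric])
  then obtain G where G: "countable G" "G \<subseteq> C\<^sub>c \<inter> \<F>" and T_eq: "T = ?S ` G"
    by (elim exE conjE)
  have G_Un: "\<Union>(?S ` G) = \<Union>(?S ` (C\<^sub>c \<inter> \<F>))"
    using T(3) unfolding T_eq .
  have sep: "\<exists>f\<in>G. f x \<noteq> f y" if xy: "x \<noteq> y" for x y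
  proof -
    have "(x, y) \<in> \<Union>(?S ` (C\<^sub>c \<inter> \<F>))"
      using exists_separating_function[OF xy] by simp
    then show ?thesis unfolding G_Un[symmetric] by simp
  qed
  have "G \<noteq> {}" using sep two_points by blast
  then have range: "range (from_nat_into G) = G" using G(1) by (rule range_from_nat_into)
  show ?thesis
  proof (intro exI[of _ "from_nat_into G"] conjI allI impI)
    show "from_nat_into G k \<in> C\<^sub>c \<inter> \<F>" for k
      using range G(2) by blast
    show "\<exists>k. from_nat_into G k x \<noteq> from_nat_into G k y" if "x \<noteq> y" for x y
      using sep[OF that] range by (metis imageE)
  qed
qed

section \<open>Modulus of the family of all curves\<close>

text \<open>The line integral over \<open>I\<close> is a supremum over compact subintervals, so for
  admissibility one compact piece with distinct end points is enough.\<close>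

lemma nonconstant_curve_segment:
  assumes "(I, \<gamma>) \<in> curves" "locally_rectifiable (I, \<gamma>)"
  shows "\<exists>s t. s \<in> I \<and> t \<in> I \<and> s \<le> t \<and> \<gamma> s \<noteq> \<gamma> t \<and> continuous_on {s..t} \<gamma> \<and> curve_length \<gamma> s t < \<infinity>"
proof -
  obtain a b where ab: "a \<in> I" "b \<in> I" "\<gamma> a \<noteq> \<gamma> b"
    using assms(1) by (auto simp: curves_def)
  define s where "s = min a b"
  define t where "t = max a b"
  have st: "s \<in> I" "t \<in> I" "s \<le> t" "\<gamma> s \<noteq> \<gamma> t"
    using ab by (auto simp: s_def t_def min_def max_def)
  have "is_interval I" using assms(1) by (simp add: curves_def)
  then have "{s..t} \<subseteq> I"
    using mem_is_interval_1_I[OF _ st(1,2)] by (intro subsetI) simp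
  then have "continuous_on {s..t} \<gamma>"
    using assms(1) by (auto simp: curves_def intro: continuous_on_subset)
  moreover have "curve_length \<gamma> s t < \<infinity>"
    using assms(2) st(1,2) by (simp add: locally_rectifiable_def)
  ultimately show ?thesis using st by blast
qed

lemma (in regular_local_dirichlet_space) modulus_curves_eq_zero:
  assumes p: "1 < p" and \<Psi>: "scale_function \<Psi>" and vd: "volume_doubling m"
    and PI: "poincare_inequality p \<Psi> m \<F> \<Gamma>"
    and small: "Liminf (at_right 0) (\<lambda>r. ereal (\<Psi> r / r powr p)) = 0"
  shows "modulus m p curves = 0"
proof -
  have sets_m: "sets m = sets borel" using radon by (simp add: radon_measure_def)
  note [measurable_cong] = sets_m
  obtain u :: "nat \<Rightarrow> 'a \<Rightarrow> real" where u: "\<And>k. u k \<in> C\<^sub>c" "\<And>k. u k \<in> \<F>"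
    and sep: "\<And>x y. x \<noteq> y \<Longrightarrow> \<exists>k. u k x \<noteq> u k y"
    using countable_separating_family by blast
  have "modulus m p curves \<le> ennreal \<epsilon>" if "\<epsilon> > 0" for \<epsilon>
  proof -
    \<comment> \<open>The index \<open>n\<close> encodes a pair (k,j): the function
      \<open>u k\<close> with the multiplier j + 1. The multipliers make up for arbitrarily small
      differences of \<open>u k\<close> at the end points.\<close>
    define f where "f n = u (fst (prod_decode n))" for n
    define N where "N n = real (Suc (snd (prod_decode n)))" for n
    \<comment> \<open>The bound \<open>1 / N n\<close> forces the radii to 0 as the multiplier
      grows, and the bounds on the integrals sum to \<open>\<epsilon>\<close>.\<close>
    have "\<exists>R H. 0 < R \<and> R < 1 / N n \<and> H \<in> borel_measurable borel \<and>
        (\<integral>\<^sup>+ x. H x \<partial>m) \<le> ennreal (\<epsilon> * (1 / 2) ^ Suc n) \<and>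
        (\<forall>z z' w. dist z w \<le> R / 2 \<longrightarrow> dist z' w \<le> R / 2 \<longrightarrow>
          ennreal \<bar>N n * average m (ball z R) (f n) - N n * average m (ball z' R) (f n)\<bar>
            \<le> ennreal (R / 4) * enn_powr (H w) (1 / p))" for n
      by (rule oscillation_density[OF p \<Psi> vd PI small]) (use u(2) \<open>\<epsilon> > 0\<close> in \<open>simp_all add: f_def N_def\<close>)
    then obtain R H where R: "\<And>n. 0 < R n" "\<And>n. R n < 1 / N n"
      and H [measurable]: "\<And>n. H n \<in> borel_measurable borel"
      and H_int: "\<And>n. (\<integral>\<^sup>+ x. H n x \<partial>m) \<le> ennreal (\<epsilon> * (1 / 2) ^ Suc n)"
      and osc: "\<And>n z z' w. \<lbrakk>dist z w \<le> R n / 2; dist z' w \<le> R n / 2\<rbrakk> \<Longrightarrow>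
          ennreal \<bar>N n * average m (ball z (R n)) (f n) - N n * average m (ball z' (R n)) (f n)\<bar>
            \<le> ennreal (R n / 4) * enn_powr (H n w) (1 / p)"
      by metis
    \<comment> \<open>Summing before taking the root makes the integral of \<rho>^p equal to the sum
      of the integrals, while \<open>\<rho>\<close> still dominates the root of each
      \<open>H n\<close>.\<close>
    define \<rho> where "\<rho> w = enn_powr (\<Sum>n. H n w) (1 / p)" for w
    have \<rho>_meas: "\<rho> \<in> borel_measurable borel"
      unfolding \<rho>_def by measurable
    have "(\<integral>\<^sup>+ x. enn_powr (\<rho> x) p \<partial>m) = (\<integral>\<^sup>+ x. (\<Sum>n. H n x) \<partial>m)"
      using p by (simp add: \<rho>_def enn_powr_inverse)
    also have "\<dots> = (\<Sum>n. \<integral>\<^sup>+ x. H n x \<partial>m)"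
      by (rule nn_integral_suminf) measurable
    also have "\<dots> \<le> (\<Sum>n. ennreal (\<epsilon> * (1 / 2) ^ Suc n))"
      by (intro suminf_le H_int) auto
    also have "\<dots> = ennreal (\<epsilon> * 1)"
      using \<open>\<epsilon> > 0\<close> by (intro suminf_ennreal_eq sums_mult power_half_series) auto
    finally have \<rho>_int: "(\<integral>\<^sup>+ x. enn_powr (\<rho> x) p \<partial>m) \<le> ennreal \<epsilon>" by simp
    have "line_integral \<rho> (I, \<gamma>) \<ge> 1"
      if curve: "(I, \<gamma>) \<in> curves" "locally_rectifiable (I, \<gamma>)" for I \<gamma>
    proof -
      obtain s t where st: "s \<in> I" "t \<in> I" "s \<le> t" "\<gamma> s \<noteq> \<gamma> t"
        and \<gamma>: "continuous_on {s..t} \<gamma>" "curve_length \<gamma> s t < \<infinity>"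
        using nonconstant_curve_segment[OF curve] by blast
      define x where "x = \<gamma> s"
      define y where "y = \<gamma> t"
      define L where "L = enn2real (curve_length \<gamma> s t)"
      define \<sigma> where "\<sigma> = arc_length_param \<gamma> s t"
      have \<sigma>: "1-lipschitz_on {0..L} \<sigma>" "\<sigma> 0 = x" "\<sigma> L = y"
        unfolding \<sigma>_def L_def x_def y_def by (rule arc_length_param_props[OF \<gamma>(1) st(3) \<gamma>(2)])+
      have "L > 0"
      proof -
        have "0 < ennreal (dist x y)" using st(4) by (simp add: x_def y_def)
        also have "\<dots> \<le> curve_length \<gamma> s t"
          unfolding x_def y_def by (rule dist_le_curve_length[OF st(3)])
        finally show ?thesis using \<gamma>(2) by (simp add: L_def enn2real_positive_iff)
      qed
      obtain k where k: "u k x \<noteq> u k y" using sep st(4) by (auto simp: x_def y_def)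
      define d where "d = \<bar>u k x - u k y\<bar>"
      have "d > 0" using k by (simp add: d_def)
      have "\<exists>\<delta>>0. \<forall>r. 0 < r \<and> r < \<delta> \<longrightarrow> \<bar>average m (ball z r) (u k) - u k z\<bar> \<le> d / 4" for z
        using u(1)[of k] \<open>d > 0\<close>
        by (intro average_near_value vd sets_m) (auto simp: compactly_supported_continuous_def)
      then obtain \<delta> where \<delta>: "\<And>z. \<delta> z > 0"
        "\<And>z r. \<lbrakk>0 < r; r < \<delta> z\<rbrakk> \<Longrightarrow> \<bar>average m (ball z r) (u k) - u k z\<bar> \<le> d / 4"
        by metis
      \<comment> \<open>The entry 2/d makes the multiplier times d/2 at least 1. The others bring
        the radius below both scales at which averages are close to values, and below
        \<open>L\<close> as chaining requires.\<close>
      define q where "q = Max {2 / d, 1 / \<delta> x, 1 / \<delta> y, 1 / L}"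
      obtain j where "q < real j" using reals_Archimedean2 by blast
      then have j: "2 / d < real (Suc j)" "1 / \<delta> x < real (Suc j)" "1 / \<delta> y < real (Suc j)" "1 / L < real (Suc j)"
        by (auto simp: q_def)
      define n where "n = prod_encode (k, j)"
      have n: "f n = u k" "N n = real (Suc j)" by (simp_all add: f_def N_def n_def)
      have "1 / N n < \<delta> x" "1 / N n < \<delta> y" "1 / N n < L"
        using j \<delta>(1)[of x] \<delta>(1)[of y] \<open>L > 0\<close> unfolding n by (auto simp: field_simps)
      then have Rn: "R n < \<delta> x" "R n < \<delta> y" "R n < L"
        using R(2)[of n] by auto
      define \<phi> where "\<phi> z = N n * average m (ball z (R n)) (u k)" for z
      have step: "ennreal \<bar>\<phi> z - \<phi> z'\<bar> \<le> ennreal (R n / 2 / 2) * \<rho> w"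
        if "dist z w \<le> R n / 2" "dist z' w \<le> R n / 2" for z z' w
      proof -
        have "H n w \<le> (\<Sum>i. H i w)"
          using sum_le_suminf[of "\<lambda>i. H i w" "{n}"] by simp
        then have "enn_powr (H n w) (1 / p) \<le> \<rho> w"
          unfolding \<rho>_def using p by (intro enn_powr_mono) auto
        then have "ennreal (R n / 4) * enn_powr (H n w) (1 / p) \<le> ennreal (R n / 4) * \<rho> w"
          by (intro mult_left_mono) auto
        from order_trans[OF osc[OF that] this] show ?thesis by (simp add: \<phi>_def n(1))
      qed
      have close: "\<bar>average m (ball x (R n)) (u k) - u k x\<bar> \<le> d / 4" "\<bar>average m (ball y (R n)) (u k) - u k y\<bar> \<le> d / 4"
        using \<delta>(2) R(1) Rn by auto
      have "1 \<le> N n * (d / 2)"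
        using j(1) \<open>d > 0\<close> unfolding n by (simp add: field_simps)
      \<comment> \<open>The values differ by \<open>d\<close> and each average is off by at most
        d/4, which leaves d/2.\<close>
      also have "\<dots> \<le> N n * \<bar>average m (ball x (R n)) (u k) - average m (ball y (R n)) (u k)\<bar>"
        using close unfolding n d_def by (intro mult_left_mono) (auto simp: abs_if split: if_splits)
      also have "\<dots> = \<bar>\<phi> (\<sigma> 0) - \<phi> (\<sigma> L)\<bar>"
        unfolding \<phi>_def \<sigma> n right_diff_distrib[symmetric] abs_mult by simp
      finally have "1 \<le> ennreal \<bar>\<phi> (\<sigma> 0) - \<phi> (\<sigma> L)\<bar>"
        by (simp add: ennreal_1[symmetric] del: ennreal_1)
      also have "\<dots> \<le> (\<integral>\<^sup>+ a \<in> {0..L}. \<rho> (\<sigma> a) \<partial>lborel)"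
        by (rule abs_diff_le_nn_integral_chain[OF \<sigma>(1) _ _ step]) (use R(1)[of n] Rn(3) in auto)
      also have "\<dots> = segment_integral \<rho> \<gamma> s t"
        by (simp add: segment_integral_def \<sigma>_def L_def)
      also have "\<dots> \<le> line_integral \<rho> (I, \<gamma>)"
        unfolding line_integral_def using st by (auto intro!: SUP_upper2[of "(s, t)"])
      finally show ?thesis .
    qed
    then have "admissible curves \<rho>"
      using \<rho>_meas by (auto simp: admissible_def)
    then have "modulus m p curves \<le> (\<integral>\<^sup>+ x. enn_powr (\<rho> x) p \<partial>m)"
      unfolding modulus_def by (intro INF_lower) simp
    also note \<rho>_int
    finally show ?thesis .
  qed
  note le = this
  have "modulus m p curves \<le> 0"
  proof (rule ennreal_le_epsilon)
    fix \<epsilon> :: real assume "\<epsilon> > 0"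
    from le[OF this] show "modulus m p curves \<le> 0 + ennreal \<epsilon>" by simp
  qed
  then show ?thesis by simp
qed

section \<open>Newtonian functions\<close>

text \<open>As \<open>u\<close> and \<open>v\<close> are limits of simple functions only almost
  everywhere, the norm of their difference is first replaced by a measurable function
  \<open>w\<close> equal to it almost everywhere.\<close>

lemma lp_norm_vec_diff_eq_zero_iff:
  fixes u v :: "'a \<Rightarrow> 'v::real_normed_vector"
  assumes "strongly_measurable m u" "strongly_measurable m v"
  shows "lp_norm_vec m p (\<lambda>x. u x - v x) = 0 \<longleftrightarrow> (AE x in m. u x = v x)"
proof -
  obtain s t where s: "\<And>i. simple_function m (s i)" "AE x in m. (\<lambda>i. s i x) \<longlonglongrightarrow> u x"
    and t: "\<And>i. simple_function m (t i)" "AE x in m. (\<lambda>i. t i x) \<longlonglongrightarrow> v x"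
    using assms unfolding strongly_measurable_def by blast
  from s(2) t(2) have "AE x in m. (\<lambda>i. norm (s i x - t i x)) \<longlonglongrightarrow> norm (u x - v x)"
    by eventually_elim (intro tendsto_intros)
  then obtain Z where Z_sub: "{x \<in> space m. \<not> (\<lambda>i. norm (s i x - t i x)) \<longlonglongrightarrow> norm (u x - v x)} \<subseteq> Z"
    and Z: "Z \<in> null_sets m"
    by (auto simp: eventually_ae_filter)
  \<comment> \<open>Off the null set \<open>Z\<close> this is the limit of the norms of simple
    functions; the value 0 on \<open>Z\<close> makes it a pointwise limit of measurable functions
    everywhere.\<close>
  define w where "w x = (if x \<in> Z then 0 else norm (u x - v x))" for x
  have [measurable]: "Z \<in> sets m" using Z by auto
  have [measurable]: "(\<lambda>x. norm (s i x - t i x)) \<in> borel_measurable m" for i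
    by (intro borel_measurable_simple_function simple_function_compose2[OF s(1) t(1)])
  have w_meas [measurable]: "w \<in> borel_measurable m"
  proof (rule borel_measurable_LIMSEQ_real)
    show "(\<lambda>i. if x \<in> Z then 0 else norm (s i x - t i x)) \<longlonglongrightarrow> w x" if "x \<in> space m" for x
      using Z_sub that by (auto simp: w_def)
  qed measurable
  have w_AE: "AE x in m. norm (u x - v x) = w x"
    by (rule AE_I'[OF Z]) (auto simp: w_def)
  have "lp_norm_vec m p (\<lambda>x. u x - v x) = 0 \<longleftrightarrow> (\<integral>\<^sup>+ x. enn_powr (ennreal (norm (u x - v x))) p \<partial>m) = 0"
    by (simp add: lp_norm_def enn_powr_eq_zero_iff)
  also have "(\<integral>\<^sup>+ x. enn_powr (ennreal (norm (u x - v x))) p \<partial>m) = (\<integral>\<^sup>+ x. enn_powr (ennreal (w x)) p \<partial>m)"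
    by (rule nn_integral_cong_AE) (use w_AE in \<open>eventually_elim, simp\<close>)
  also have "\<dots> = 0 \<longleftrightarrow> (AE x in m. enn_powr (ennreal (w x)) p = 0)"
    by (rule nn_integral_0_iff_AE) measurable
  also have "\<dots> \<longleftrightarrow> (AE x in m. u x = v x)"
  proof -
    have "enn_powr (ennreal (w x)) p = 0 \<longleftrightarrow> w x = 0" for x
      by (auto simp: enn_powr_eq_zero_iff ennreal_eq_0_iff w_def)
    moreover have "(AE x in m. w x = 0) \<longleftrightarrow> (AE x in m. u x = v x)"
    proof
      assume "AE x in m. w x = 0"
      with w_AE show "AE x in m. u x = v x" by eventually_elim simp
    next
      assume "AE x in m. u x = v x"
      with w_AE show "AE x in m. w x = 0" by eventually_elim simp
    qed
    ultimately show ?thesis by simp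
  qed
  finally show ?thesis .
qed

theorem corollary1p3:
  fixes p :: real
    and \<Psi> :: "real \<Rightarrow> real"
    and m :: "'a::{complete_space, second_countable_topology} measure"
    and \<E> :: "('a \<Rightarrow> real) \<Rightarrow> real"
    and \<F> :: "('a \<Rightarrow> real) set"
    and \<Gamma> :: "('a \<Rightarrow> real) \<Rightarrow> 'a measure"
  assumes "1 < p"
    and "scale_function \<Psi>"
    and "regular_local_dirichlet_space p m \<E> \<F> \<Gamma>"
    and "volume_doubling m"
    and "poincare_inequality p \<Psi> m \<F> \<Gamma>"
    and "Liminf (at_right 0) (\<lambda>r. ereal (\<Psi> r / r powr p)) = 0"
  shows "newtonian_space m p = (bochner_lp_space m p :: ('a \<Rightarrow> 'v::banach) set set)"
proof -
  interpret regular_local_dirichlet_space p m \<E> \<F> \<Gamma> by fact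
  have mod: "modulus m p curves = 0"
    using assms(1,2,4,5,6) by (rule modulus_curves_eq_zero)
  \<comment> \<open>With all curves as exceptional family the upper gradient inequality is
    vacuous.\<close>
  have zero_gradient: "weak_upper_gradient m p u (\<lambda>_. 0)" for u :: "'a \<Rightarrow> 'v"
    unfolding weak_upper_gradient_def using mod by (intro conjI exI[of _ curves]) auto
  have norm0: "lp_norm m p (\<lambda>_. 0) = 0"
    by (simp add: lp_norm_def)
  \<comment> \<open>The zero gradient kills the infimum, so the Newtonian seminorm of every function
    reduces to its p-norm.\<close>
  have seminorm: "newtonian_seminorm m p u = lp_norm_vec m p u" for u :: "'a \<Rightarrow> 'v"
  proof -
    have "(INF \<rho> \<in> {\<rho>. weak_upper_gradient m p u \<rho>}. lp_norm m p \<rho>) \<le> lp_norm m p (\<lambda>_. 0)"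
      using zero_gradient by (intro INF_lower) simp
    then show ?thesis by (simp add: newtonian_seminorm_def norm0)
  qed
  show ?thesis
    unfolding newtonian_space_eq_bochner_lp_space_iff
  proof (intro conjI allI impI ballI)
    fix u :: "'a \<Rightarrow> 'v" assume "u \<in> bochner_lp_fun m p"
    then show "u \<in> newtonian_fun m p"
      using zero_gradient[of u] norm0 by (auto simp: newtonian_fun_def intro!: exI[of _ "\<lambda>_. 0"])
  next
    fix u v :: "'a \<Rightarrow> 'v" assume "u \<in> bochner_lp_fun m p" "v \<in> bochner_lp_fun m p"
    then show "newtonian_seminorm m p (\<lambda>x. u x - v x) = 0 \<longleftrightarrow> (AE x in m. u x = v x)"
      unfolding seminorm by (intro lp_norm_vec_diff_eq_zero_iff) (simp_all add: bochner_lp_fun_def)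
  qed
qed

end
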